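(* Let $(X,x_0)$ and $(Y,y_0)$ be based digital images. If $X$ and $Y$ are subdivision-based homotopy equivalent, then they have isomorphic fundamental groups: $\pi_1(X;x_0)\cong\pi_1(Y;y_0)$.
   Context: A digital image is a finite subset $X \subseteq \mathbb{Z}^n$ with adjacency relation $x \sim_X x'$ iff $|x_i - x'_i| \le 1$ for every $i=1,\dots,n$. A function of digital images is continuous if it sends adjacent points to adjacent points; a based map is a continuous function preserving basepoints. $I_N = \{0,1,\dots,N\}\subseteq\mathbb{Z}$; products of digital images are Cartesian products with adjacency in each factor. Based maps $f,g\colon X\to Y$ are based homotopic, $f\approx g$, if for some $N\ge1$ there is a continuous $H\colon X\times I_N\to Y$ with $H(x,0)=f(x)$, $H(x,N)=g(x)$ for all $x$ and $H(x_0,t)=y_0$ for all $t$. For $k\ge1$, the $k$-subdivision of $X\subseteq\mathbb{Z}^n$ is $S(X,k)=\{(y_1,\dots,y_n)\in\mathbb{Z}^n : (\lfloor y_1/k\rfloor,\dots,\lfloor y_n/k\rfloor)\in X\}$, with continuous standard projection $\rho_k\colon S(X,k)\to X$, $\rho_k(y_1,\dots,y_n)=(\lfloor y_1/k\rfloor,\dots,\lfloor y_n/k\rfloor)$ ($S(X,1)=X$, $\rho_1=\mathrm{id}$). One identifies $S(S(X,k),k')=S(X,kk')$, so there is also $\rho_{k'}\colon S(X,kk')\to S(X,k)$. If $X$ has basepoint $x_0=(a_1,\dots,a_n)$, the basepoint of $S(X,k)$ is $\overline{x_0}=(ka_1+c,\dots,ka_n+c)$, $c=\lfloor (k-1)/2\rfloor$.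 Based maps $f\colon S(X,k)\to Y$ and $g\colon S(X,l)\to Y$ are subdivision-based homotopic if, for some $k',l'\ge1$ with $kk'=ll'=m$, there is a based homotopy $f\circ\rho_{k'}\approx g\circ\rho_{l'}\colon S(X,m)\to Y$. Based digital images $X$ and $Y$ are subdivision-based homotopy equivalent if for some $k,l\ge1$ there are: (a) based maps $f\colon S(X,k)\to Y$ and $g\colon S(Y,l)\to X$; (b) based maps $F\colon S(X,kl)\to S(Y,l)$ and $G\colon S(Y,kl)\to S(X,k)$ with $\rho_l\circ F=f\circ\rho_l$ (as maps $S(X,kl)\to Y$) and $\rho_k\circ G=g\circ\rho_k$ (as maps $S(Y,kl)\to X$); (c) $f\circ G\colon S(Y,kl)\to Y$ is subdivision-based homotopic to $\mathrm{id}_Y$ and $g\circ F\colon S(X,kl)\to X$ is subdivision-based homotopic to $\mathrm{id}_X$. Fundamental group: for a based digital image $(Y,y_0)$, a based loop of length $N\ge 1$ is a continuous $\gamma\colon I_N\to Y$ with $\gamma(0)=\gamma(N)=y_0$. Based loops $\alpha,\beta\colon I_M\to Y$ are based homotopic as based loops, $\alpha\approx\beta$, if for some $R\ge1$ there is a continuous $H\colon I_M\times I_R\to Y$ with $H(s,0)=\alpha(s)$, $H(s,R)=\beta(s)$ and $H(0,t)=H(M,t)=y_0$ for all $s,t$. With $\rho_k\colon I_{kN+k-1}\to I_N$, $\rho_k(s)=\lfloor s/k\rfloor$, based loops $\alpha\colon I_M\to Y$, $\beta\colon I_N\to Y$ are subdivision-based homotopic as based loops if for some $k,l\ge1$ with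 $k(M+1)=l(N+1)$ we have $\alpha\circ\rho_k\approx\beta\circ\rho_l$ as based loops. This is an equivalence relation; $[\alpha]$ is the class of $\alpha$ and $\pi_1(Y;y_0)$ the set of classes, a group under $[\alpha]\cdot[\beta]=[\alpha\cdot\beta]$, where $\alpha\cdot\beta\colon I_{M+N+1}\to Y$ is $\alpha(t)$ for $0\le t\le M$ and $\beta(t-(M+1))$ for $M+1\le t\le M+N+1$. *)

theory Defs
  imports "HOL-Analysis.Finite_Cartesian_Product" "HOL-Algebra.Group"
begin

section \<open>Digital images\<close>

text \<open>
  A digital image is a finite set \<open>X :: (int ^ 'n) set\<close>. The adjacency of \<open>\<int>\<close>, of \<open>\<int>\<^sup>n\<close>
  and of products is given by one overloaded relation, so that continuity has a single
  definition for the domains \<open>X\<close>, \<open>I\<^sub>N\<close>, \<open>X \<times> I\<^sub>N\<close> and \<open>I\<^sub>M \<times> I\<^sub>R\<close>. The relation is reflexive.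
\<close>

class adjacency =
  fixes adjacent :: "'a \<Rightarrow> 'a \<Rightarrow> bool"

instantiation int :: adjacency
begin
definition adjacent_int_def: "adjacent (a::int) b \<longleftrightarrow> \<bar>a - b\<bar> \<le> 1"
instance ..
end

instantiation vec :: (adjacency, finite) adjacency
begin
definition adjacent_vec_def: "adjacent (x :: 'a ^ 'b) y \<longleftrightarrow> (\<forall>i. adjacent (x $ i) (y $ i))"
instance ..
end

instantiation prod :: (adjacency, adjacency) adjacency
begin
definition adjacent_prod_def:
  "adjacent (p :: 'a \<times> 'b) q \<longleftrightarrow> adjacent (fst p) (fst q) \<and> adjacent (snd p) (snd q)"
instance ..
end

definition based_digital_image :: "(int ^ 'n) set \<Rightarrow> int ^ 'n \<Rightarrow> bool" where
  "based_digital_image X x0 \<longleftrightarrow> finite X \<and> x0 \<in> X"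

text \<open>
  Maps are total HOL functions; only their values on the domain \<open>X\<close> are ever used.
\<close>

definition digital_continuous ::
    "'a::adjacency set \<Rightarrow> 'b::adjacency set \<Rightarrow> ('a \<Rightarrow> 'b) \<Rightarrow> bool" where
  "digital_continuous X Y f \<longleftrightarrow>
     (\<forall>x\<in>X. f x \<in> Y) \<and> (\<forall>x\<in>X. \<forall>x'\<in>X. adjacent x x' \<longrightarrow> adjacent (f x) (f x'))"

definition based_map ::
    "'a::adjacency set \<Rightarrow> 'a \<Rightarrow> 'b::adjacency set \<Rightarrow> 'b \<Rightarrow> ('a \<Rightarrow> 'b) \<Rightarrow> bool" where
  "based_map X x0 Y y0 f \<longleftrightarrow> digital_continuous X Y f \<and> f x0 = y0"

definition digital_interval :: "nat \<Rightarrow> int set" where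
  "digital_interval N = {0..int N}"

definition based_homotopic ::
    "'a::adjacency set \<Rightarrow> 'a \<Rightarrow> 'b::adjacency set \<Rightarrow> 'b \<Rightarrow> ('a \<Rightarrow> 'b) \<Rightarrow> ('a \<Rightarrow> 'b) \<Rightarrow> bool" where
  "based_homotopic X x0 Y y0 f g \<longleftrightarrow>
     (\<exists>N\<ge>1. \<exists>H. digital_continuous (X \<times> digital_interval N) Y H \<and>
        (\<forall>x\<in>X. H (x, 0) = f x \<and> H (x, int N) = g x) \<and>
        (\<forall>t\<in>digital_interval N. H (x0, t) = y0))"

section \<open>Subdivision\<close>

definition std_proj :: "nat \<Rightarrow> int ^ 'n \<Rightarrow> int ^ 'n" where
  "std_proj k y = (\<chi> i. y $ i div int k)"

definition subdivision :: "(int ^ 'n) set \<Rightarrow> nat \<Rightarrow> (int ^ 'n) set" where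
  "subdivision X k = {y. std_proj k y \<in> X}"

text \<open>
  The basepoint of \<open>S(X, k)\<close>. It is not compatible with iterated subdivision: the basepoint of
  \<open>S(X, k * l)\<close> is always \<open>subdiv_base (k * l) x0\<close>, which in general differs from
  \<open>subdiv_base l (subdiv_base k x0)\<close>. Both are mapped to \<open>subdiv_base k x0\<close> by \<open>std_proj l\<close>.
\<close>

definition subdiv_base :: "nat \<Rightarrow> int ^ 'n \<Rightarrow> int ^ 'n" where
  "subdiv_base k x0 = (\<chi> i. int k * x0 $ i + (int k - 1) div 2)"

text \<open>Here \<open>f\<close> is a map on \<open>S(X, k)\<close> and \<open>g\<close> a map on \<open>S(X, l)\<close>.\<close>

definition subdiv_based_homotopic ::
    "(int ^ 'm) set \<Rightarrow> int ^ 'm \<Rightarrow> (int ^ 'n) set \<Rightarrow> int ^ 'n \<Rightarrow>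
     nat \<Rightarrow> (int ^ 'm \<Rightarrow> int ^ 'n) \<Rightarrow> nat \<Rightarrow> (int ^ 'm \<Rightarrow> int ^ 'n) \<Rightarrow> bool" where
  "subdiv_based_homotopic X x0 Y y0 k f l g \<longleftrightarrow>
     (\<exists>k'\<ge>1. \<exists>l'\<ge>1. k * k' = l * l' \<and>
        based_homotopic (subdivision X (k * k')) (subdiv_base (k * k') x0) Y y0
          (f \<circ> std_proj k') (g \<circ> std_proj l'))"

definition subdiv_based_homotopy_equivalent ::
    "(int ^ 'm) set \<Rightarrow> int ^ 'm \<Rightarrow> (int ^ 'n) set \<Rightarrow> int ^ 'n \<Rightarrow> bool" where
  "subdiv_based_homotopy_equivalent X x0 Y y0 \<longleftrightarrow>
     (\<exists>k\<ge>1. \<exists>l\<ge>1. \<exists>f g F G.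
        based_map (subdivision X k) (subdiv_base k x0) Y y0 f \<and>
        based_map (subdivision Y l) (subdiv_base l y0) X x0 g \<and>
        based_map (subdivision X (k * l)) (subdiv_base (k * l) x0)
                  (subdivision Y l) (subdiv_base l y0) F \<and>
        based_map (subdivision Y (k * l)) (subdiv_base (k * l) y0)
                  (subdivision X k) (subdiv_base k x0) G \<and>
        (\<forall>x\<in>subdivision X (k * l). std_proj l (F x) = f (std_proj l x)) \<and>
        (\<forall>y\<in>subdivision Y (k * l). std_proj k (G y) = g (std_proj k y)) \<and>
        subdiv_based_homotopic Y y0 Y y0 (k * l) (f \<circ> G) 1 id \<and>
        subdiv_based_homotopic X x0 X x0 (k * l) (g \<circ> F) 1 id)"

section \<open>The fundamental group\<close>

text \<open>
  A loop is a pair \<open>(N, \<gamma>)\<close> of its length and a function of which only the values on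
  \<open>I\<^sub>N = {0..N}\<close> matter. Pairs whose functions agree on \<open>I\<^sub>N\<close> are related by a constant
  homotopy, so the set of classes does not depend on the values outside \<open>I\<^sub>N\<close>.
\<close>

type_synonym 'a digital_loop = "nat \<times> (int \<Rightarrow> 'a)"

definition based_loops :: "'a::adjacency set \<Rightarrow> 'a \<Rightarrow> 'a digital_loop set" where
  "based_loops Y y0 =
     {(N, \<gamma>). N \<ge> 1 \<and> digital_continuous (digital_interval N) Y \<gamma> \<and>
              \<gamma> 0 = y0 \<and> \<gamma> (int N) = y0}"

definition loop_homotopic ::
    "'a::adjacency set \<Rightarrow> 'a \<Rightarrow> nat \<Rightarrow> (int \<Rightarrow> 'a) \<Rightarrow> (int \<Rightarrow> 'a) \<Rightarrow> bool" where
  "loop_homotopic Y y0 M \<alpha> \<beta> \<longleftrightarrow>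
     (\<exists>R\<ge>1. \<exists>H. digital_continuous (digital_interval M \<times> digital_interval R) Y H \<and>
        (\<forall>s\<in>digital_interval M. H (s, 0) = \<alpha> s \<and> H (s, int R) = \<beta> s) \<and>
        (\<forall>t\<in>digital_interval R. H (0, t) = y0 \<and> H (int M, t) = y0))"

definition interval_proj :: "nat \<Rightarrow> int \<Rightarrow> int" where
  "interval_proj k s = s div int k"

definition subdiv_loop_rel ::
    "'a::adjacency set \<Rightarrow> 'a \<Rightarrow> ('a digital_loop \<times> 'a digital_loop) set" where
  "subdiv_loop_rel Y y0 =
     {((M, \<alpha>), (N, \<beta>)). (M, \<alpha>) \<in> based_loops Y y0 \<and> (N, \<beta>) \<in> based_loops Y y0 \<and>
        (\<exists>k\<ge>1. \<exists>l\<ge>1. k * (M + 1) = l * (N + 1) \<and>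
           loop_homotopic Y y0 (k * M + k - 1) (\<alpha> \<circ> interval_proj k) (\<beta> \<circ> interval_proj l))}"

fun loop_concat :: "'a digital_loop \<Rightarrow> 'a digital_loop \<Rightarrow> 'a digital_loop" where
  "loop_concat (M, \<alpha>) (N, \<beta>) =
     (M + N + 1, \<lambda>t. if t \<le> int M then \<alpha> t else \<beta> (t - (int M + 1)))"

text \<open>
  The union over all representatives in the product is the usual rendering of a well-defined
  operation on classes: its terms all coincide with \<open>[\<alpha> \<cdot> \<beta>]\<close>.
\<close>

definition fundamental_group ::
    "'a::adjacency set \<Rightarrow> 'a \<Rightarrow> 'a digital_loop set monoid" where
  "fundamental_group Y y0 =
     \<lparr>carrier = based_loops Y y0 // subdiv_loop_rel Y y0,
      mult = (\<lambda>A B. \<Union>\<alpha>\<in>A. \<Union>\<beta>\<in>B. subdiv_loop_rel Y y0 `` {loop_concat \<alpha> \<beta>}),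
      one = subdiv_loop_rel Y y0 `` {(1, \<lambda>_. y0)}\<rparr>"

end

theory Submission
  imports Defs
begin

text \<open>
  Let \<open>f\<close>, \<open>g\<close>, \<open>F\<close>, \<open>G\<close> be the data of an equivalence, with \<open>f\<close> defined on \<open>S(X, k)\<close>. The
  isomorphism is the composite of the inverse of \<open>\<rho>\<^sub>k : \<pi>\<^sub>1(S(X, k)) \<rightarrow> \<pi>\<^sub>1(X)\<close> with
  \<open>f : \<pi>\<^sub>1(S(X, k)) \<rightarrow> \<pi>\<^sub>1(Y)\<close>, and the two things to see are that the projections \<open>\<rho>\<close> are bijective
  on classes of loops and that \<open>f\<close> is.

  Both are decided combinatorially. An edge path is a list of points in which neighbours are
  adjacent, and \<open>edge_equiv\<close> is generated by repeating a point and by going around a triangle: this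
  is homotopy of edge paths in the clique complex. A loop becomes the list of its values, and
  subdividing a loop only repeats letters. A step of a homotopy is a strip of squares with all
  diagonals, so homotopic loops are edge equivalent (\<open>edge_equiv_prism\<close>). Conversely, letters
  repeated at different places can be slid together without changing the length of the list
  (\<open>slide_letters\<close>), so that edge equivalent loops have homotopic subdivisions. Hence two loops
  define the same element of \<open>\<pi>\<^sub>1\<close> iff their lists are edge equivalent (\<open>subdiv_loop_rel_iff\<close>).

  A map is bijective on classes of loops if it has a section on points and the preimage of every
  clique is connected and simply connected: a path downstairs is lifted edge by edge, and any two
  choices over an edge or a triangle are equivalent (locale \<open>simply_connected_fibres\<close>). This applies
  to \<open>\<rho>\<^sub>k : S(X, k) \<rightarrow> X\<close>. A clique lies in a unit cube \<open>b + {0, 1}\<^sup>n\<close>, so its preimage lies in a box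
  of side \<open>2 k\<close>, and clamping the coordinates towards the middle of the box contracts the preimage,
  within itself, to a clique (\<open>squeeze\<close>).

  Since \<open>f \<circ> G\<close> and \<open>g \<circ> F\<close> become homotopic to projections after a subdivision, they too are
  bijective on classes (\<open>loop_bijective_of_homotopic\<close>). So \<open>f\<close> is surjective and \<open>F\<close> is injective,
  and \<open>\<rho>\<^sub>l \<circ> F = f \<circ> \<rho>\<^sub>l\<close> with bijective projections turns injectivity of \<open>F\<close> into that of \<open>f\<close>.
\<close>

section \<open>Edge paths\<close>

text \<open>
  The usual name for a reflexive and symmetric relation is tolerance.
\<close>

class tolerance = adjacency +
  assumes adjacent_refl [simp, intro!]: "adjacent x x"
    and adjacent_sym: "adjacent x y \<Longrightarrow> adjacent y x"

instance int :: tolerance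
  by standard (auto simp: adjacent_int_def)

instance vec :: (tolerance, finite) tolerance
  by standard (auto simp: adjacent_vec_def intro: adjacent_sym)

instance prod :: (tolerance, tolerance) tolerance
  by standard (auto simp: adjacent_prod_def intro: adjacent_sym)

definition edge_path :: "'a::adjacency set \<Rightarrow> 'a list \<Rightarrow> bool" where
  "edge_path Y xs \<longleftrightarrow> xs \<noteq> [] \<and> set xs \<subseteq> Y \<and> successively adjacent xs"

lemma edge_path_Cons:
  "edge_path Y (x # xs) \<longleftrightarrow> x \<in> Y \<and> (xs = [] \<or> adjacent x (hd xs) \<and> edge_path Y xs)"
  by (cases xs) (auto simp: edge_path_def)

lemma edge_path_Nil [simp]: "\<not> edge_path Y []"
  by (simp add: edge_path_def)

lemma edge_path_append:
  "xs \<noteq> [] \<Longrightarrow> ys \<noteq> [] \<Longrightarrow>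
     edge_path Y (xs @ ys) \<longleftrightarrow> edge_path Y xs \<and> edge_path Y ys \<and> adjacent (last xs) (hd ys)"
  by (auto simp: edge_path_def successively_append_iff)

lemma edge_path_map:
  assumes "edge_path A ps" "digital_continuous A Y f"
  shows "edge_path Y (map f ps)"
  using assms by (auto simp: edge_path_def digital_continuous_def successively_map subset_iff
      elim!: successively_mono)

lemma edge_path_mono: "edge_path A ps \<Longrightarrow> A \<subseteq> B \<Longrightarrow> edge_path B ps"
  by (auto simp: edge_path_def)

lemma edge_path_hd_in: "edge_path A ps \<Longrightarrow> hd ps \<in> A"
  and edge_path_last_in: "edge_path A ps \<Longrightarrow> last ps \<in> A"
  by (auto simp: edge_path_def)

text \<open>
  Deleting \<open>x\<close> from \<open>a, x, b\<close> is allowed only when \<open>a\<close> and \<open>b\<close> are adjacent, so that the three points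
  span a triangle. Taking \<open>a = b\<close> cancels a detour \<open>a, x, a\<close>. The end points never change.
\<close>

inductive edge_equiv :: "'a::tolerance set \<Rightarrow> 'a list \<Rightarrow> 'a list \<Rightarrow> bool" for Y where
  refl: "edge_path Y xs \<Longrightarrow> edge_equiv Y xs xs"
| sym: "edge_equiv Y xs ys \<Longrightarrow> edge_equiv Y ys xs"
| trans [trans]: "edge_equiv Y xs ys \<Longrightarrow> edge_equiv Y ys zs \<Longrightarrow> edge_equiv Y xs zs"
| repeat: "edge_path Y (u @ a # v) \<Longrightarrow> edge_equiv Y (u @ a # v) (u @ a # a # v)"
| triangle: "edge_path Y (u @ a # b # v) \<Longrightarrow> x \<in> Y \<Longrightarrow> adjacent a x \<Longrightarrow> adjacent x b \<Longrightarrow>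
    edge_equiv Y (u @ a # b # v) (u @ a # x # b # v)"

lemma edge_path_insert:
  assumes "edge_path Y (u @ a # v)" "x \<in> Y" "adjacent a x" "v \<noteq> [] \<Longrightarrow> adjacent x (hd v)"
  shows "edge_path Y (u @ a # x # v)"
  using assms
  by (cases "u = []") (auto simp: edge_path_append edge_path_Cons)

lemma edge_equiv_props:
  "edge_equiv Y xs ys \<Longrightarrow> edge_path Y xs \<and> edge_path Y ys \<and> hd xs = hd ys \<and> last xs = last ys"
proof (induction rule: edge_equiv.induct)
  case (repeat u a v)
  have "a \<in> Y" using repeat by (auto simp: edge_path_def)
  moreover have "v \<noteq> [] \<Longrightarrow> adjacent a (hd v)"
    using repeat by (cases "u = []") (auto simp: edge_path_append edge_path_Cons)
  ultimately show ?case using repeat edge_path_insert[of Y u a v a] by (cases u) auto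
next
  case (triangle u a b v x)
  then show ?case using edge_path_insert[of Y u a "b # v" x] by (cases u) auto
qed auto

lemma edge_equiv_context:
  assumes "edge_equiv Y xs ys" "edge_path Y (u @ xs @ v)"
  shows "edge_equiv Y (u @ xs @ v) (u @ ys @ v)"
proof -
  have transfer: "edge_path Y (u @ ys @ v)"
    if "edge_equiv Y xs ys" "edge_path Y (u @ xs @ v)" for xs ys
  proof -
    have *: "edge_path Y xs" "edge_path Y ys" "hd xs = hd ys" "last xs = last ys"
      using edge_equiv_props[OF that(1)] by auto
    then have ne: "xs \<noteq> []" "ys \<noteq> []" by auto
    show ?thesis
      using that(2) * ne by (cases "u = []"; cases "v = []") (auto simp: edge_path_append)
  qed
  show ?thesis using assms
  proof (induction rule: edge_equiv.induct)
    case (sym xs ys)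
    then show ?case using transfer edge_equiv.sym by blast
  next
    case (trans xs ys zs)
    then show ?case using transfer edge_equiv.trans by blast
  next
    case (repeat u' a v')
    then show ?case using edge_equiv.repeat[of Y "u @ u'" a "v' @ v"] by simp
  next
    case (triangle u' a b v' x)
    then show ?case using edge_equiv.triangle[of Y "u @ u'" a b "v' @ v" x] by simp
  qed (auto intro: edge_equiv.refl)
qed

lemma edge_equiv_append:
  assumes "edge_equiv Y xs xs'" "edge_equiv Y ys ys'" "edge_path Y (xs @ ys)"
  shows "edge_equiv Y (xs @ ys) (xs' @ ys')"
proof -
  have 1: "edge_equiv Y (xs @ ys) (xs' @ ys)"
    using edge_equiv_context[OF assms(1), of "[]" ys] assms(3) by simp
  then have "edge_path Y (xs' @ ys)" using edge_equiv_props by blast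
  then have "edge_equiv Y (xs' @ ys) (xs' @ ys')"
    using edge_equiv_context[OF assms(2), of "xs'" "[]"] by simp
  with 1 show ?thesis by (rule edge_equiv.trans)
qed

lemma edge_equiv_Cons:
  assumes "edge_equiv Y xs ys" "edge_path Y (x # xs)"
  shows "edge_equiv Y (x # xs) (x # ys)"
  using edge_equiv_context[OF assms(1), of "[x]" "[]"] assms(2) by simp

lemma edge_equiv_map:
  assumes "edge_equiv A xs ys" "digital_continuous A Y f"
  shows "edge_equiv Y (map f xs) (map f ys)"
  using assms(1)
proof (induction rule: edge_equiv.induct)
  case (repeat u a v)
  then show ?case
    using edge_equiv.repeat[of Y "map f u" "f a" "map f v"] edge_path_map[OF _ assms(2)] by force
next
  case (triangle u a b v x)
  then have "a \<in> A" "b \<in> A" by (auto simp: edge_path_def)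
  then show ?case
    using edge_equiv.triangle[of Y "map f u" "f a" "f b" "map f v" "f x"]
      edge_path_map[OF triangle(1) assms(2)] triangle assms(2)
    by (auto simp: digital_continuous_def)
qed (auto intro: edge_equiv.intros edge_path_map[OF _ assms(2)])

lemma edge_equiv_repeat_hd:
  assumes "edge_path Y xs" 
  shows "edge_equiv Y xs (replicate n (hd xs) @ xs)"
proof (induction n)
  case 0
  then show ?case using assms by (simp add: edge_equiv.refl)
next
  case (Suc n)
  define ys where "ys = replicate n (hd xs) @ xs"
  have "xs \<noteq> []" using assms by auto
  then obtain ys' where ys': "ys = hd xs # ys'"
    unfolding ys_def by (cases n; cases xs) auto
  have "edge_equiv Y ys (hd xs # ys)"
    using edge_equiv.repeat[of Y "[]" "hd xs" ys'] edge_equiv_props[OF Suc] ys' ys_def by simp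
  with Suc show ?case by (auto simp: ys_def intro: edge_equiv.trans)
qed

lemma edge_equiv_repeat_last:
  assumes "edge_path Y xs"
  shows "edge_equiv Y xs (xs @ [last xs])"
proof -
  have "xs = butlast xs @ [last xs]" using assms by (cases xs rule: rev_cases) auto
  then show ?thesis
    using edge_equiv.repeat[of Y "butlast xs" "last xs" "[]"] assms
    by (metis append.assoc append_Cons append_Nil)
qed

definition clique :: "'a::adjacency set \<Rightarrow> bool" where
  "clique C \<longleftrightarrow> (\<forall>x\<in>C. \<forall>y\<in>C. adjacent x y)"

lemma clique_pair: "adjacent x y \<Longrightarrow> clique {x, y :: 'a::tolerance}"
  by (auto simp: clique_def intro: adjacent_sym)

text \<open>
  Any three points of a clique span a triangle, so the interior points of a path can be dropped one
  after another.
\<close>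

lemma edge_equiv_clique:
  assumes "edge_path C ps" "C \<subseteq> Y" "clique C"
  shows "edge_equiv Y ps [hd ps, last ps]"
  using assms(1)
proof (induction ps)
  case (Cons p ps)
  have Y: "edge_path Y (p # ps)" using Cons.prems assms(2) edge_path_mono by blast
  show ?case
  proof (cases "ps = []")
    case True
    then show ?thesis using Y edge_equiv.repeat[of Y "[]" p "[]"] by simp
  next
    case False
    then have ps: "edge_path C ps" and p: "p \<in> C" using Cons.prems by (auto simp: edge_path_Cons)
    then have in_C: "hd ps \<in> C" "last ps \<in> C" by (auto simp: edge_path_hd_in edge_path_last_in)
    have "edge_equiv Y (p # ps) (p # [hd ps, last ps])"
      using edge_equiv_Cons[OF Cons.IH[OF ps] Y] .
    also have "edge_equiv Y (p # [hd ps, last ps]) [p, last ps]"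
      using edge_equiv.triangle[of Y "[]" p "last ps" "[]" "hd ps"] in_C p assms(2,3)
      by (auto simp: edge_path_Cons clique_def intro!: edge_equiv.sym[of _ "[p, last ps]"])
    finally show ?thesis using False by simp
  qed
qed simp

text \<open>
  The paths \<open>map f ps\<close> and \<open>map g ps\<close> bound a strip of squares whose diagonals \<open>f p, g q\<close> are edges.
  Pushing the path across the strip takes two triangles per square.
\<close>

lemma edge_equiv_prism:
  fixes A :: "'b::tolerance set"
  assumes "edge_path A ps"
    and f: "digital_continuous A Y f" and g: "digital_continuous A Y g"
    and close: "\<And>p q. p \<in> A \<Longrightarrow> q \<in> A \<Longrightarrow> adjacent p q \<Longrightarrow> adjacent (f p) (g q)"
  shows "edge_equiv Y (map f ps) (f (hd ps) # map g ps @ [f (last ps)])"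
  using assms(1)
proof (induction ps)
  case (Cons p ps)
  have p: "p \<in> A" "f p \<in> Y" "g p \<in> Y" "adjacent (f p) (g p)"
    using Cons.prems f g close by (auto simp: edge_path_Cons digital_continuous_def)
  show ?case
  proof (cases ps)
    case Nil
    have "edge_path {f p, g p} [f p, g p, f p]"
      using p by (auto simp: edge_path_def adjacent_sym)
    then have "edge_equiv Y [f p, g p, f p] [f p, f p]"
      using edge_equiv_clique[of "{f p, g p}" "[f p, g p, f p]" Y] clique_pair[OF p(4)] p by simp
    moreover have "edge_equiv Y [f p] [f p, f p]"
      using edge_equiv.repeat[of Y "[]" "f p" "[]"] p by (simp add: edge_path_Cons)
    ultimately show ?thesis using Nil by (auto intro: edge_equiv.trans edge_equiv.sym)
  next
    case (Cons q qs)
    have ps: "edge_path A ps" and pq: "adjacent p q"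
      using Cons.prems Cons by (auto simp: edge_path_Cons)
    then have q: "q \<in> A" "f q \<in> Y" "g q \<in> Y"
      using Cons f g by (auto simp: edge_path_Cons digital_continuous_def)
    have adj: "adjacent (f p) (f q)" "adjacent (f p) (g q)" "adjacent (g p) (g q)"
        "adjacent (f q) (g q)"
      using pq p q f g close by (auto simp: digital_continuous_def)
    define rest where "rest = map g qs @ [f (last ps)]"
    have IH: "edge_equiv Y (map f ps) (f q # g q # rest)"
      using Cons.IH[OF ps] Cons by (simp add: rest_def)
    have "edge_path Y (f p # map f ps)"
      using edge_path_map[OF Cons.prems f] by simp
    from edge_equiv_Cons[OF IH this]
    have 1: "edge_equiv Y (map f (p # ps)) (f p # f q # g q # rest)" by simp
    have tail: "edge_path Y (g q # rest)"
      using edge_equiv_props[OF IH] by (auto simp: edge_path_Cons)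
    have 2: "edge_equiv Y (f p # g q # rest) (f p # f q # g q # rest)"
      using edge_equiv.triangle[of Y "[]" "f p" "g q" rest "f q"] tail adj p q
      by (simp add: edge_path_Cons)
    have 3: "edge_equiv Y (f p # g q # rest) (f p # g p # g q # rest)"
      using edge_equiv.triangle[of Y "[]" "f p" "g q" rest "g p"] tail adj p q
      by (simp add: edge_path_Cons)
    from 1 2 3 have "edge_equiv Y (map f (p # ps)) (f p # g p # g q # rest)"
      by (blast intro: edge_equiv.trans edge_equiv.sym)
    then show ?thesis using Cons by (simp add: rest_def)
  qed
qed simp

lemma edge_equiv_prism_rel_ends:
  fixes A :: "'b::tolerance set"
  assumes "edge_path A ps"
    and f: "digital_continuous A Y f" and g: "digital_continuous A Y g"
    and close: "\<And>p q. p \<in> A \<Longrightarrow> q \<in> A \<Longrightarrow> adjacent p q \<Longrightarrow> adjacent (f p) (g q)"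
    and ends: "f (hd ps) = g (hd ps)" "f (last ps) = g (last ps)"
  shows "edge_equiv Y (map f ps) (map g ps)"
proof -
  have ne: "ps \<noteq> []" using assms(1) by auto
  have gp: "edge_path Y (map g ps)" using assms(1) g edge_path_map by blast
  have 1: "edge_equiv Y (map f ps) (f (hd ps) # map g ps @ [f (last ps)])"
    using edge_equiv_prism[OF assms(1-3) close] .
  have "edge_equiv Y (map g ps) (map g ps @ [f (last ps)])"
    using edge_equiv_repeat_last[OF gp] ends ne by (simp add: last_map)
  also have "edge_equiv Y \<dots> (f (hd ps) # map g ps @ [f (last ps)])"
    using edge_equiv_repeat_hd[of Y "map g ps @ [f (last ps)]" 1] calculation
      edge_equiv_props ends ne by (auto simp: hd_append hd_map)
  finally show ?thesis using 1 by (blast intro: edge_equiv.trans edge_equiv.sym)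
qed

section \<open>Sliding repeated letters\<close>

text \<open>
  Nudges keep the length and the end points: they are the elementary homotopies rel end points
  of loops of a fixed length. As the neighbours of the moved point stay where they are, the diagonals of the
  homotopy are edges as soon as both lists are paths.
\<close>

definition nudge :: "'a::tolerance set \<Rightarrow> 'a list \<Rightarrow> 'a list \<Rightarrow> bool" where
  "nudge Y xs ys \<longleftrightarrow> edge_path Y xs \<and> edge_path Y ys \<and>
     (\<exists>n v. 0 < n \<and> Suc n < length xs \<and> ys = xs[n := v] \<and> adjacent (xs ! n) v)"

lemma nudge_props:
  assumes "nudge Y xs ys"
  shows "length ys = length xs" "hd ys = hd xs" "last ys = last xs" "edge_path Y xs" "edge_path Y ys"
proof -
  obtain n v where n: "0 < n" "Suc n < length xs" "ys = xs[n := v]"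
    and p: "edge_path Y xs" "edge_path Y ys"
    using assms by (auto simp: nudge_def)
  then have ne: "xs \<noteq> []" "ys \<noteq> []" by auto
  show "length ys = length xs" "edge_path Y xs" "edge_path Y ys" using n p by auto
  show "hd ys = hd xs" "last ys = last xs"
    using n ne by (auto simp: hd_conv_nth last_conv_nth nth_list_update)
qed

lemma nudges_props:
  assumes "(nudge Y)\<^sup>*\<^sup>* xs ys"
  shows "length ys = length xs \<and> hd ys = hd xs \<and> last ys = last xs
    \<and> (edge_path Y xs \<longrightarrow> edge_path Y ys)"
  using assms by (induction rule: rtranclp_induct) (auto dest: nudge_props)

lemma nudge_sym:
  assumes "nudge Y xs ys"
  shows "nudge Y ys xs"
proof -
  obtain n v where n: "0 < n" "Suc n < length xs" "ys = xs[n := v]" "adjacent (xs ! n) v"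
    and p: "edge_path Y xs" "edge_path Y ys"
    using assms by (auto simp: nudge_def)
  have "xs = ys[n := xs ! n]" "adjacent (ys ! n) (xs ! n)" "Suc n < length ys"
    using n by (auto intro: adjacent_sym)
  then show ?thesis unfolding nudge_def using n(1) p by blast
qed

lemma nudges_sym: "(nudge Y)\<^sup>*\<^sup>* xs ys \<Longrightarrow> (nudge Y)\<^sup>*\<^sup>* ys xs"
  by (metis nudge_sym sympD sympI symp_rtranclp)

lemma nudgeI:
  assumes "edge_path Y (u @ a # x # b # w)" "v \<in> Y"
    "adjacent x v" "adjacent a v" "adjacent v b"
  shows "nudge Y (u @ a # x # b # w) (u @ a # v # b # w)"
proof -
  have "edge_path Y (u @ a # v # b # w)"
    using assms by (cases "u = []") (auto simp: edge_path_append edge_path_Cons)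
  then show ?thesis unfolding nudge_def
    using assms by (intro conjI exI[of _ "Suc (length u)"] exI[of _ v])
      (auto simp: list_update_append nth_append)
qed

lemma nudge_Cons:
  assumes "nudge Y xs ys" "adjacent x (hd xs)" "x \<in> Y"
  shows "nudge Y (x # xs) (x # ys)"
proof -
  obtain n v where n: "0 < n" "Suc n < length xs" "ys = xs[n := v]" "adjacent (xs ! n) v"
    using assms by (auto simp: nudge_def)
  then have "0 < Suc n \<and> Suc (Suc n) < length (x # xs) \<and> x # ys = (x # xs)[Suc n := v]
      \<and> adjacent ((x # xs) ! Suc n) v" by simp
  moreover have "edge_path Y (x # xs)" "edge_path Y (x # ys)"
    using nudge_props[OF assms(1)] assms by (auto simp: edge_path_Cons)
  ultimately show ?thesis unfolding nudge_def by blast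
qed

lemma nudges_Cons:
  assumes "(nudge Y)\<^sup>*\<^sup>* xs ys" "adjacent x (hd xs)" "x \<in> Y"
  shows "(nudge Y)\<^sup>*\<^sup>* (x # xs) (x # ys)"
  using assms(1)
proof (induction rule: rtranclp_induct)
  case (step ys zs)
  then have "nudge Y (x # ys) (x # zs)"
    using assms nudges_props[OF step(1)] by (intro nudge_Cons) auto
  with step show ?case by simp
qed simp

lemma nudges_replicate:
  assumes "(nudge Y)\<^sup>*\<^sup>* xs ys" "edge_path Y xs"
  shows "(nudge Y)\<^sup>*\<^sup>* (replicate n (hd xs) @ xs) (replicate n (hd xs) @ ys)"
proof (induction n)
  case (Suc n)
  have "xs \<noteq> []" "hd xs \<in> Y" using assms(2) by (auto simp: edge_path_hd_in)
  moreover have "hd (replicate n (hd xs) @ xs) = hd xs" by (cases n) auto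
  ultimately show ?case using Suc by (auto intro!: nudges_Cons)
qed (use assms in simp)

text \<open>
  The neighbours \<open>a\<close> and \<open>b\<close> of the moved point need not be adjacent; hence \<open>v\<close> is inserted
  between \<open>x\<close> and \<open>b\<close> before \<open>x\<close> is removed from between \<open>a\<close> and \<open>v\<close>.
\<close>

lemma nudge_imp_edge_equiv:
  assumes "nudge Y xs ys"
  shows "edge_equiv Y xs ys"
proof -
  obtain n v where n: "0 < n" "Suc n < length xs" "ys = xs[n := v]" "adjacent (xs ! n) v"
    and p: "edge_path Y xs" "edge_path Y ys"
    using assms by (auto simp: nudge_def)
  obtain m where m: "n = Suc m" using n(1) gr0_implies_Suc by blast
  define u w a x b where "u = take m xs" and "w = drop (Suc (Suc n)) xs"
    and "a = xs ! m" and "x = xs ! n" and "b = xs ! Suc n"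
  have "drop m xs = a # x # b # w"
    unfolding w_def a_def x_def b_def m using n(2) m by (simp add: Cons_nth_drop_Suc)
  then have xs: "xs = u @ a # x # b # w"
    unfolding u_def by (metis append_take_drop_id)
  have len: "n = Suc (length u)" unfolding u_def using n m by simp
  have ys: "ys = u @ a # v # b # w"
    unfolding n(3) by (subst xs) (simp add: len list_update_append)
  have "adjacent x v" using n(4) by (simp add: x_def)
  moreover have "adjacent x b" "adjacent a x" "x \<in> Y"
    using p(1) unfolding xs by (auto simp: edge_path_def successively_append_iff)
  moreover have "adjacent a v" "adjacent v b" "v \<in> Y"
    using p(2) unfolding ys by (auto simp: edge_path_def successively_append_iff)
  ultimately have ab: "adjacent x b" "adjacent a x" "adjacent a v" "adjacent v b" "adjacent x v"
    "v \<in> Y" "x \<in> Y" by auto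
  have "edge_equiv Y (u @ a # x # b # w) (u @ a # x # v # b # w)"
    using edge_equiv.triangle[of Y "u @ [a]" x b w v] p(1) ab by (simp add: xs)
  moreover have "edge_equiv Y (u @ a # v # b # w) (u @ a # x # v # b # w)"
    using edge_equiv.triangle[of Y u a v "b # w" x] p(2) ab by (simp add: ys)
  ultimately show ?thesis unfolding xs ys by (blast intro: edge_equiv.trans edge_equiv.sym)
qed

lemma nudges_imp_edge_equiv:
  "(nudge Y)\<^sup>*\<^sup>* xs ys \<Longrightarrow> edge_path Y xs \<Longrightarrow> edge_equiv Y xs ys"
  by (induction rule: rtranclp_induct)
    (auto intro: edge_equiv.refl edge_equiv.trans nudge_imp_edge_equiv)

text \<open>
  A doubled letter travels to the right: \<open>c, c, d\<close> is nudged to \<open>c, d, d\<close>. Thus it does not matter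
  at which place of a list a letter is doubled.
\<close>

lemma slide_letter:
  "edge_path Y (u @ a # v) \<Longrightarrow> (nudge Y)\<^sup>*\<^sup>* (hd (u @ [a]) # u @ a # v) (u @ a # a # v)"
proof (induction u)
  case (Cons c u)
  define d where "d = hd (u @ [a])"
  obtain w where w: "u @ a # v = d # w" unfolding d_def by (cases u) auto
  have d: "adjacent c d" "edge_path Y (u @ a # v)" "c \<in> Y" "d \<in> Y"
    using Cons.prems w by (auto simp: edge_path_Cons)
  have "nudge Y ([] @ c # c # d # w) ([] @ c # d # d # w)"
    using Cons.prems d w by (intro nudgeI) (auto simp: edge_path_Cons)
  moreover have "(nudge Y)\<^sup>*\<^sup>* (c # d # u @ a # v) (c # u @ a # a # v)"
    using Cons.IH d by (intro nudges_Cons) (auto simp: d_def)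
  ultimately show ?case using w by auto
qed auto

lemma slide_letters:
  assumes "edge_path Y (u @ a # v)"
  shows "(nudge Y)\<^sup>*\<^sup>* (replicate n (hd (u @ [a])) @ u @ a # v) (u @ replicate n a @ a # v)"
proof (induction n)
  case (Suc n)
  define d where "d = hd (u @ [a])"
  have hd: "hd (u @ a # v) = d" by (cases u) (auto simp: d_def)
  then have d: "d \<in> Y" using edge_path_hd_in[OF assms] by simp
  have 1: "edge_path Y (u @ a # replicate n a @ v)"
  proof -
    have "edge_path Y (replicate n d @ u @ a # v)"
      using edge_equiv_repeat_hd[OF assms, of n] edge_equiv_props by (auto simp: hd)
    with Suc have "edge_path Y (u @ replicate n a @ a # v)"
      using nudges_props by (auto simp: d_def)
    then show ?thesis by (simp add: replicate_app_Cons_same)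
  qed
  have "(nudge Y)\<^sup>*\<^sup>* (d # replicate n d @ u @ a # v) (d # u @ replicate n a @ a # v)"
    using Suc d hd by (intro nudges_Cons) (auto simp: d_def hd_append)
  also have "(nudge Y)\<^sup>*\<^sup>* (d # u @ replicate n a @ a # v) (u @ a # a # replicate n a @ v)"
    using slide_letter[OF 1] by (simp add: d_def replicate_app_Cons_same)
  finally show ?case by (simp add: d_def replicate_app_Cons_same)
qed simp

text \<open>
  The list of values of a \<open>k\<close>-fold subdivided loop.
\<close>

definition stutter :: "nat \<Rightarrow> 'a list \<Rightarrow> 'a list" where
  "stutter k xs = map (\<lambda>i. xs ! (i div k)) [0..<k * length xs]"

lemma stutter_Nil [simp]: "stutter k [] = []"
  by (simp add: stutter_def)

lemma stutter_Cons: "1 \<le> k \<Longrightarrow> stutter k (x # xs) = replicate k x @ stutter k xs"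
  by (rule nth_equalityI) (auto simp: stutter_def nth_append div_if less_diff_conv2 nth_Cons')

lemma nudges_stutter:
  assumes "1 \<le> k" "edge_path Y xs"
  shows "(nudge Y)\<^sup>*\<^sup>* (stutter k xs) (replicate ((k - 1) * length xs) (hd xs) @ xs)"
  using assms(2)
proof (induction xs)
  case (Cons x xs)
  obtain j where k: "k = Suc j" using assms(1) by (cases k) auto
  have rep: "(nudge Y)\<^sup>*\<^sup>* (replicate i x @ ys) (replicate i x @ zs)"
    if "(nudge Y)\<^sup>*\<^sup>* ys zs" "adjacent x (hd ys)" "x \<in> Y" for i ys zs
  proof (induction i)
    case (Suc i)
    then show ?case using that by (cases i) (auto intro!: nudges_Cons)
  qed (use that in simp)
  show ?case
  proof (cases xs)
    case Nil
    then show ?thesis using assms(1) k by (simp add: stutter_Cons replicate_append_same)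
  next
    case (Cons d v)
    have xs: "edge_path Y xs" "adjacent x d" "x \<in> Y"
      using Cons.prems Cons by (auto simp: edge_path_Cons)
    let ?m = "j * length xs"
    have hd_st: "hd (stutter k xs) = d" using Cons assms(1) k by (simp add: stutter_Cons)
    have "(nudge Y)\<^sup>*\<^sup>* (replicate k x @ stutter k xs) (replicate k x @ replicate ?m d @ xs)"
      using Cons.IH[OF xs(1)] xs Cons hd_st k by (intro rep) auto
    also have "replicate k x @ replicate ?m d @ xs = replicate j x @ (x # replicate ?m d @ d # v)"
      using k Cons by (simp add: replicate_append_same replicate_app_Cons_same)
    also have "(nudge Y)\<^sup>*\<^sup>* (replicate j x @ (x # replicate ?m d @ d # v))
                          (replicate j x @ (replicate ?m x @ x # d # v))"
      using slide_letters[of Y "[x]" d v ?m] Cons.prems xs Cons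
      by (intro rep) (auto dest: nudges_sym)
    finally show ?thesis
      using k Cons assms(1) by (simp add: stutter_Cons replicate_add)
  qed
qed simp

text \<open>
  Padding with copies of the first letter makes lists of different length comparable. It provides
  the doubled letter that a move needs: slide one to the place, then nudge it away.
\<close>

lemma edge_equiv_imp_nudges:
  assumes "edge_equiv Y xs ys"
  shows "\<exists>p q. (nudge Y)\<^sup>*\<^sup>* (replicate p (hd xs) @ xs) (replicate q (hd xs) @ ys)"
  using assms
proof (induction rule: edge_equiv.induct)
  case (refl xs)
  show ?case by blast
next
  case (sym xs ys)
  then show ?case using nudges_sym edge_equiv_props by metis
next
  case (trans xs ys zs)
  obtain p q where pq: "(nudge Y)\<^sup>*\<^sup>* (replicate p (hd xs) @ xs) (replicate q (hd xs) @ ys)"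
    using trans by blast
  obtain p' q' where pq': "(nudge Y)\<^sup>*\<^sup>* (replicate p' (hd xs) @ ys) (replicate q' (hd xs) @ zs)"
    using trans edge_equiv_props by metis
  have pad: "(nudge Y)\<^sup>*\<^sup>* (replicate (n + p) a @ xs) (replicate (n + q) a @ ys)"
    if "(nudge Y)\<^sup>*\<^sup>* (replicate p a @ xs) (replicate q a @ ys)" "hd xs = a" "edge_path Y xs"
    for n p q a xs ys
  proof -
    have "hd (replicate p a @ xs) = a" using that(2) by (cases p) auto
    moreover have "edge_path Y (replicate p a @ xs)"
      using edge_equiv_repeat_hd[of Y xs p] edge_equiv_props that by auto
    ultimately show ?thesis using nudges_replicate[OF that(1), of n] by (simp add: replicate_add)
  qed
  have "(nudge Y)\<^sup>*\<^sup>* (replicate (p' + p) (hd xs) @ xs) (replicate (p' + q) (hd xs) @ ys)"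
    using pad[OF pq] trans edge_equiv_props by blast
  also have "(nudge Y)\<^sup>*\<^sup>* (replicate (p' + q) (hd xs) @ ys) (replicate (q + q') (hd xs) @ zs)"
    using pad[OF pq', of q] trans edge_equiv_props by (metis add.commute)
  finally show ?case by blast
next
  case (repeat u a v)
  have "hd (u @ a # v) = hd (u @ [a])" by (cases u) auto
  with slide_letter[OF repeat] show ?case
    by (intro exI[of _ 1] exI[of _ 0]) simp
next
  case (triangle u a b v x)
  have hd: "hd (u @ a # b # v) = hd (u @ [a])" by (cases u) auto
  have "edge_path Y (u @ a # a # b # v)"
    using edge_equiv_props[OF edge_equiv.repeat[OF triangle(1)]] by blast
  then have "nudge Y (u @ a # a # b # v) (u @ a # x # b # v)"
    using triangle by (intro nudgeI) auto
  with slide_letter[OF triangle(1)] show ?case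
    by (intro exI[of _ 1] exI[of _ 0]) (simp add: hd)
qed


section \<open>Loops as words\<close>

fun word :: "'a digital_loop \<Rightarrow> 'a list" where
  "word (N, \<gamma>) = map \<gamma> [0..int N]"

lemma length_word [simp]: "length (word (N, \<gamma>)) = Suc N"
  by simp

lemma nth_word: "i \<le> N \<Longrightarrow> word (N, \<gamma>) ! i = \<gamma> (int i)"
  by simp

lemma word_eqI:
  assumes "length xs = Suc N" "\<And>i. i \<le> N \<Longrightarrow> xs ! i = \<gamma> (int i)"
  shows "word (N, \<gamma>) = xs"
  using assms by (intro nth_equalityI) auto

declare word.simps [simp del]

lemma hd_word [simp]: "hd (word (N, \<gamma>)) = \<gamma> 0"
  by (simp add: word.simps upto_rec1)

lemma last_word [simp]: "last (word (N, \<gamma>)) = \<gamma> (int N)"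
  by (simp add: word.simps upto_rec2)

lemma word_neq_Nil [simp]: "word \<alpha> \<noteq> []"
  by (cases \<alpha>) (simp add: word.simps)

lemma edge_path_upto: "edge_path (digital_interval N) [0..int N]"
proof -
  have "successively adjacent [0..int N]"
    by (auto simp: successively_conv_nth adjacent_int_def)
  then show ?thesis by (auto simp: edge_path_def digital_interval_def)
qed

lemma edge_path_word:
  fixes \<gamma> :: "int \<Rightarrow> 'a::tolerance"
  shows "edge_path Y (word (N, \<gamma>)) \<longleftrightarrow> digital_continuous (digital_interval N) Y \<gamma>"
proof
  assume path: "edge_path Y (word (N, \<gamma>))"
  have step: "adjacent (\<gamma> s) (\<gamma> (s + 1))" if "0 \<le> s" "s + 1 \<le> int N" for s
    using path that successively_nth[of adjacent "word (N, \<gamma>)" "nat s"]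
    by (simp add: edge_path_def nth_word nat_le_iff add.commute)
  have "\<gamma> s \<in> Y" if "s \<in> digital_interval N" for s
    using path that by (auto simp: edge_path_def word.simps digital_interval_def)
  moreover have "adjacent (\<gamma> s) (\<gamma> s')"
    if "s \<in> digital_interval N" "s' \<in> digital_interval N" "adjacent s s'" for s s'
  proof -
    have "\<bar>s - s'\<bar> \<le> 1" using that(3) by (simp add: adjacent_int_def)
    then consider "s' = s" | "s' = s + 1" | "s = s' + 1" by linarith
    then show ?thesis
      by cases (use that step in \<open>auto simp: digital_interval_def intro: adjacent_sym\<close>)
  qed
  ultimately show "digital_continuous (digital_interval N) Y \<gamma>"
    by (auto simp: digital_continuous_def)
qed (auto simp: word.simps intro: edge_path_map edge_path_upto)

definition loop_word :: "'a::tolerance set \<Rightarrow> 'a \<Rightarrow> 'a list \<Rightarrow> bool" where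
  "loop_word Y y0 xs \<longleftrightarrow> edge_path Y xs \<and> hd xs = y0 \<and> last xs = y0"

lemma based_loops_iff:
  "(N, \<gamma>) \<in> based_loops Y y0 \<longleftrightarrow> 1 \<le> N \<and> loop_word Y y0 (word (N, \<gamma>))"
  by (auto simp: based_loops_def loop_word_def edge_path_word)

lemma loop_wordD:
  "\<alpha> \<in> based_loops Y y0 \<Longrightarrow> loop_word Y y0 (word \<alpha>)"
  by (cases \<alpha>) (auto simp: based_loops_iff)

lemma loop_word_equiv: "loop_word Y y0 xs \<Longrightarrow> edge_equiv Y xs ys \<Longrightarrow> loop_word Y y0 ys"
  by (auto simp: loop_word_def dest: edge_equiv_props)

text \<open>
  A single point is an edge path but not a loop, as loops have length at least one; repeating the
  base point at the front covers this case.
\<close>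

lemma loop_of_word:
  assumes "loop_word Y y0 xs"
  obtains \<alpha> where "\<alpha> \<in> based_loops Y y0" "edge_equiv Y (word \<alpha>) xs"
proof -
  let ?\<alpha> = "(length xs, \<lambda>t. (y0 # xs) ! nat t)"
  have w: "word ?\<alpha> = y0 # xs" by (rule word_eqI) auto
  have "edge_equiv Y xs (y0 # xs)"
    using edge_equiv_repeat_hd[of Y xs 1] assms by (simp add: loop_word_def)
  moreover have "xs \<noteq> []" using assms by (auto simp: loop_word_def)
  ultimately show ?thesis
    using that[of ?\<alpha>] loop_word_equiv[OF assms, of "y0 # xs"] w
    by (auto simp: based_loops_iff Suc_le_eq intro: edge_equiv.sym)
qed

lemma word_interval_proj:
  assumes "1 \<le> k"
  shows "word (k * M + k - 1, \<alpha> \<circ> interval_proj k) = stutter k (word (M, \<alpha>))"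
proof (rule word_eqI)
  show "length (stutter k (word (M, \<alpha>))) = Suc (k * M + k - 1)"
    using assms by (simp add: stutter_def)
  fix i assume "i \<le> k * M + k - 1"
  then have i: "i < k * Suc M" using assms by simp
  then have "i div k < Suc M" using assms by (simp add: div_less_iff_less_mult mult.commute)
  then have "word (M, \<alpha>) ! (i div k) = \<alpha> (int (i div k))" by (intro nth_word) simp
  then show "stutter k (word (M, \<alpha>)) ! i = (\<alpha> \<circ> interval_proj k) (int i)"
    using i by (simp add: stutter_def interval_proj_def zdiv_int)
qed

lemma edge_equiv_stutter:
  assumes "1 \<le> k" "edge_path Y xs"
  shows "edge_equiv Y (stutter k xs) xs"
proof -
  note nudges = nudges_stutter[OF assms]
  note pad = edge_equiv_repeat_hd[OF assms(2), of "(k - 1) * length xs"]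
  have "edge_path Y (stutter k xs)"
    using nudges_props[OF nudges_sym[OF nudges]] edge_equiv_props[OF pad] by auto
  from nudges_imp_edge_equiv[OF nudges this] pad show ?thesis
    by (blast intro: edge_equiv.trans edge_equiv.sym)
qed

text \<open>
  Every time step of a homotopy is a prism. Stated for arbitrary domains, this serves homotopies of
  loops as well as homotopies of maps.
\<close>

lemma edge_equiv_homotopy:
  fixes A :: "'b::tolerance set" and H :: "'b \<times> int \<Rightarrow> 'a::tolerance"
  assumes H: "digital_continuous (A \<times> digital_interval R) Y H"
    and ps: "edge_path A ps"
    and ends: "\<And>t. t \<in> digital_interval R \<Longrightarrow> H (hd ps, t) = y0 \<and> H (last ps, t) = y0"
  shows "edge_equiv Y (map (\<lambda>p. H (p, 0)) ps) (map (\<lambda>p. H (p, int R)) ps)"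
proof -
  have slice: "digital_continuous A Y (\<lambda>p. H (p, t))" if "t \<in> digital_interval R" for t
    unfolding digital_continuous_def
  proof (intro conjI ballI impI)
    fix p q assume "p \<in> A" "q \<in> A" "adjacent p q"
    then show "adjacent (H (p, t)) (H (q, t))"
      using H that unfolding digital_continuous_def adjacent_prod_def
      by (metis SigmaI adjacent_refl fst_conv snd_conv)
  qed (use H that in \<open>simp add: digital_continuous_def\<close>)
  have "edge_equiv Y (map (\<lambda>p. H (p, 0)) ps) (map (\<lambda>p. H (p, int t)) ps)" if "t \<le> R" for t
    using that
  proof (induction t)
    case 0
    then show ?case
      using edge_path_map[OF ps slice[of 0]] by (simp add: digital_interval_def edge_equiv.refl)
  next
    case (Suc t)
    have t: "int t \<in> digital_interval R" "int (Suc t) \<in> digital_interval R"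
      using Suc.prems by (auto simp: digital_interval_def)
    have "adjacent (H (p, int t)) (H (q, int (Suc t)))"
      if "p \<in> A" "q \<in> A" "adjacent p q" for p q
    proof -
      have "adjacent (p, int t) (q, int (Suc t))"
        using that(3) by (simp add: adjacent_prod_def adjacent_int_def)
      then show ?thesis using H t that unfolding digital_continuous_def by (metis SigmaI)
    qed
    then have "edge_equiv Y (map (\<lambda>p. H (p, int t)) ps) (map (\<lambda>p. H (p, int (Suc t))) ps)"
      using t ends by (intro edge_equiv_prism_rel_ends[OF ps slice slice]) auto
    with Suc.IH Suc.prems show ?case using edge_equiv.trans Suc_leD by blast
  qed
  then show ?thesis by blast
qed

lemma loop_homotopic_imp_edge_equiv:
  fixes \<alpha> \<beta> :: "int \<Rightarrow> 'a::tolerance"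
  assumes "loop_homotopic Y y0 M \<alpha> \<beta>"
  shows "edge_equiv Y (word (M, \<alpha>)) (word (M, \<beta>))"
proof -
  obtain R H where H: "digital_continuous (digital_interval M \<times> digital_interval R) Y H"
    and slices: "\<forall>s\<in>digital_interval M. H (s, 0) = \<alpha> s \<and> H (s, int R) = \<beta> s"
    and ends: "\<forall>t\<in>digital_interval R. H (0, t) = y0 \<and> H (int M, t) = y0"
    using assms by (auto simp: loop_homotopic_def)
  have "hd [0..int M] = 0" "last [0..int M] = int M"
    by (simp add: upto_rec1, simp add: upto_rec2)
  then have "edge_equiv Y (map (\<lambda>p. H (p, 0)) [0..int M]) (map (\<lambda>p. H (p, int R)) [0..int M])"
    using ends by (intro edge_equiv_homotopy[OF H edge_path_upto]) auto
  moreover have "map (\<lambda>p. H (p, 0)) [0..int M] = word (M, \<alpha>)"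
    "map (\<lambda>p. H (p, int R)) [0..int M] = word (M, \<beta>)"
    using slices by (auto simp: word.simps digital_interval_def)
  ultimately show ?thesis by simp
qed

lemma nudge_close:
  assumes "nudge Y xs ys" "i < length xs" "j < length xs" "i \<le> Suc j" "j \<le> Suc i"
  shows "adjacent (xs ! i) (ys ! j)"
proof -
  obtain n v where n: "n < length xs" "ys = xs[n := v]" "adjacent (xs ! n) v"
    and p: "edge_path Y xs" "edge_path Y ys"
    using assms(1) unfolding nudge_def by (metis Suc_lessD)
  have close: "adjacent (zs ! i) (zs ! j)" if "edge_path Y zs" "length zs = length xs" for zs
  proof -
    consider "j = i" | "j = Suc i" | "i = Suc j" using assms(4,5) by linarith
    then show ?thesis
      by cases (use that assms(2,3) in
        \<open>auto simp: edge_path_def successively_conv_nth intro: adjacent_sym\<close>)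
  qed
  show ?thesis
  proof (cases "j = n")
    case True
    then show ?thesis using n close[OF p(2)] by (cases "i = n") auto
  next
    case False
    then show ?thesis using n close[OF p(1)] by simp
  qed
qed

text \<open>
  The lists of a chain of nudges are the time slices of a homotopy.
\<close>

lemma nudges_imp_loop_homotopic:
  fixes \<alpha> \<beta> :: "int \<Rightarrow> 'a::tolerance"
  assumes nudges: "(nudge Y)\<^sup>*\<^sup>* (word (M, \<alpha>)) (word (M, \<beta>))"
    and loop: "loop_word Y y0 (word (M, \<alpha>))"
  shows "loop_homotopic Y y0 M \<alpha> \<beta>"
proof -
  obtain R w where w0: "w 0 = word (M, \<alpha>)" and wR: "w R = word (M, \<beta>)"
    and step: "\<And>i. i < R \<Longrightarrow> nudge Y (w i) (w (Suc i))"
    using rtranclp_imp_relpowp[OF nudges] unfolding relpowp_fun_conv by blast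
  have inv: "length (w i) = Suc M \<and> loop_word Y y0 (w i)" if "i \<le> R" for i
    using that
  proof (induction i)
    case (Suc i)
    then show ?case using nudge_props[OF step[of i]] by (auto simp: loop_word_def)
  qed (use w0 loop in auto)
  \<comment> \<open>The last slice is kept for one more step, so that the homotopy has positive length.\<close>
  define H where "H = (\<lambda>(s :: int, t :: int). w (min (nat t) R) ! nat s)"
  have close: "adjacent (w i ! a) (w j ! b)"
    if "i \<le> R" "j \<le> R" "a \<le> M" "b \<le> M" "i = j \<or> j = Suc i" "a \<le> Suc b" "b \<le> Suc a" for i j a b
    using that(5)
  proof
    assume "i = j"
    have "a = b \<or> b = Suc a \<or> a = Suc b" using that(6,7) by linarith
    then show ?thesis
      using inv[OF that(1)] that(3,4) \<open>i = j\<close>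
      by (elim disjE)
        (auto simp: loop_word_def edge_path_def successively_conv_nth intro: adjacent_sym)
  next
    assume "j = Suc i"
    then show ?thesis using nudge_close[OF step[of i]] inv[of i] that by auto
  qed
  have "digital_continuous (digital_interval M \<times> digital_interval (Suc R)) Y H"
    unfolding digital_continuous_def
  proof (intro conjI ballI impI)
    fix p assume "p \<in> digital_interval M \<times> digital_interval (Suc R)"
    then show "H p \<in> Y"
      using inv[of "min (nat (snd p)) R"]
      by (auto simp: H_def loop_word_def edge_path_def digital_interval_def subset_iff
          split: prod.splits intro!: nth_mem)
  next
    fix p q assume pq: "p \<in> digital_interval M \<times> digital_interval (Suc R)"
      "q \<in> digital_interval M \<times> digital_interval (Suc R)" "adjacent p q"
    obtain s t s' t' where st: "p = (s, t)" "q = (s', t')" by fastforce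
    let ?i = "min (nat t) R" and ?j = "min (nat t') R"
    have rng: "0 \<le> s" "s \<le> int M" "0 \<le> s'" "s' \<le> int M" "\<bar>s - s'\<bar> \<le> 1" "\<bar>t - t'\<bar> \<le> 1"
      using pq st by (auto simp: digital_interval_def adjacent_prod_def adjacent_int_def)
    then have t: "?i = ?j \<or> ?j = Suc ?i \<or> ?i = Suc ?j" by linarith
    have s: "nat s \<le> M" "nat s' \<le> M" "nat s \<le> Suc (nat s')" "nat s' \<le> Suc (nat s)"
      using rng by linarith+
    have ij: "?i \<le> R" "?j \<le> R" by simp_all
    have "adjacent (w ?i ! nat s) (w ?j ! nat s')"
      using close[OF ij s(1,2) _ s(3,4)] close[OF ij(2,1) s(2,1) _ s(4,3)] t adjacent_sym by blast
    then show "adjacent (H p) (H q)" by (simp add: st H_def)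
  qed
  moreover have "\<forall>s\<in>digital_interval M. H (s, 0) = \<alpha> s \<and> H (s, int (Suc R)) = \<beta> s"
    by (auto simp: H_def w0 wR digital_interval_def nth_word nat_le_iff)
  moreover have "\<forall>t\<in>digital_interval (Suc R). H (0, t) = y0 \<and> H (int M, t) = y0"
  proof
    fix t
    have "w (min (nat t) R) \<noteq> []" using inv[of "min (nat t) R"] by auto
    then show "H (0, t) = y0 \<and> H (int M, t) = y0"
      using inv[of "min (nat t) R"] by (auto simp: H_def loop_word_def hd_conv_nth last_conv_nth)
  qed
  ultimately show ?thesis
    unfolding loop_homotopic_def by (intro exI[of _ "Suc R"] conjI exI[of _ H]) auto
qed

text \<open>
  Subdivided words reduce to the words by sliding repeated letters to the front, where they form
  a padding. The relation thereby loses its dependence on the two subdivision factors, and its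
  transitivity becomes evident.
\<close>

theorem subdiv_loop_rel_iff:
  fixes Y :: "'a::tolerance set"
  shows "(\<alpha>, \<beta>) \<in> subdiv_loop_rel Y y0 \<longleftrightarrow>
    \<alpha> \<in> based_loops Y y0 \<and> \<beta> \<in> based_loops Y y0 \<and> edge_equiv Y (word \<alpha>) (word \<beta>)"
proof (cases \<alpha>; cases \<beta>)
  fix M a N b assume ab: "\<alpha> = (M, a)" "\<beta> = (N, b)"
  have "(\<exists>k\<ge>1. \<exists>l\<ge>1. k * (M + 1) = l * (N + 1) \<and>
           loop_homotopic Y y0 (k * M + k - 1) (a \<circ> interval_proj k) (b \<circ> interval_proj l))
     \<longleftrightarrow> edge_equiv Y (word \<alpha>) (word \<beta>)" (is "?hom \<longleftrightarrow> ?eq")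
    if loops: "\<alpha> \<in> based_loops Y y0" "\<beta> \<in> based_loops Y y0"
  proof
    assume ?hom
    then obtain k l where kl: "1 \<le> k" "1 \<le> l" "k * (M + 1) = l * (N + 1)"
      and hom: "loop_homotopic Y y0 (k * M + k - 1) (a \<circ> interval_proj k) (b \<circ> interval_proj l)"
      by blast
    have len: "k * M + k - 1 = l * N + l - 1" using kl(3) by simp
    have "edge_equiv Y (stutter k (word \<alpha>)) (stutter l (word \<beta>))"
      using loop_homotopic_imp_edge_equiv[OF hom] word_interval_proj[OF kl(1), of M a]
        word_interval_proj[OF kl(2), of N b] by (simp only: ab len)
    moreover have "edge_equiv Y (stutter k (word \<alpha>)) (word \<alpha>)"
      "edge_equiv Y (stutter l (word \<beta>)) (word \<beta>)"
      using loops kl by (auto intro!: edge_equiv_stutter dest: loop_wordD simp: loop_word_def)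
    ultimately show ?eq by (blast intro: edge_equiv.trans edge_equiv.sym)
  next
    assume ?eq
    let ?x = "word \<alpha>" and ?y = "word \<beta>"
    have xy: "loop_word Y y0 ?x" "loop_word Y y0 ?y" using loops by (auto dest: loop_wordD)
    obtain p q where pq: "(nudge Y)\<^sup>*\<^sup>* (replicate p y0 @ ?x) (replicate q y0 @ ?y)"
      using edge_equiv_imp_nudges[OF \<open>?eq\<close>] xy by (auto simp: loop_word_def)
    have len_pq: "p + (M + 1) = q + (N + 1)"
      using nudges_props[OF pq] by (simp add: ab)
    \<comment> \<open>Both subdivisions have the common length \<open>(M + 1) * (N + 1) * (p + 1)\<close>; the factor \<open>p + 1\<close>
      makes it large enough to contain the padding that \<open>pq\<close> needs.\<close>
    define k l where "k = (N + 1) * (p + 1)" and "l = (M + 1) * (p + 1)"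
    have kl: "1 \<le> k" "1 \<le> l" "k * (M + 1) = l * (N + 1)" by (simp_all add: k_def l_def algebra_simps)
    define r where "r = (k - 1) * (M + 1) - p"
    have "p \<le> k - 1" unfolding k_def by simp
    also have "k - 1 \<le> (k - 1) * (M + 1)" by simp
    finally have "p \<le> (k - 1) * (M + 1)" .
    then have r: "(k - 1) * (M + 1) = r + p" unfolding r_def by simp
    moreover have "(k - 1) * (M + 1) + (M + 1) = (l - 1) * (N + 1) + (N + 1)"
      using kl by (metis Suc_pred' add.commute mult_Suc less_eq_Suc_le One_nat_def)
    ultimately have r': "(l - 1) * (N + 1) = r + q" using len_pq by linarith
    have "(nudge Y)\<^sup>*\<^sup>* (stutter k ?x) (replicate (r + p) y0 @ ?x)"
      using nudges_stutter[OF kl(1), of Y ?x] xy r by (simp add: loop_word_def ab)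
    also have "(nudge Y)\<^sup>*\<^sup>* (replicate (r + p) y0 @ ?x) (replicate (r + q) y0 @ ?y)"
    proof -
      have "hd (replicate p y0 @ ?x) = y0" using xy by (cases p) (auto simp: loop_word_def)
      moreover have "edge_path Y (replicate p y0 @ ?x)"
        using edge_equiv_repeat_hd[of Y ?x p] edge_equiv_props xy by (auto simp: loop_word_def)
      ultimately show ?thesis using nudges_replicate[OF pq, of r] by (simp add: replicate_add)
    qed
    also have "(nudge Y)\<^sup>*\<^sup>* (replicate (r + q) y0 @ ?y) (stutter l ?y)"
      using nudges_sym[OF nudges_stutter[OF kl(2), of Y ?y]] xy r'
      by (simp add: loop_word_def ab)
    finally have nudges: "(nudge Y)\<^sup>*\<^sup>* (stutter k ?x) (stutter l ?y)" .
    have "edge_equiv Y ?x (stutter k ?x)"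
      using edge_equiv_stutter[OF kl(1), of Y ?x] xy edge_equiv.sym
      by (auto simp: loop_word_def)
    then have loop: "loop_word Y y0 (stutter k ?x)" using loop_word_equiv xy by blast
    have len: "k * M + k - 1 = l * N + l - 1" using kl(3) by simp
    have "loop_homotopic Y y0 (k * M + k - 1) (a \<circ> interval_proj k) (b \<circ> interval_proj l)"
    proof (rule nudges_imp_loop_homotopic)
      show "(nudge Y)\<^sup>*\<^sup>* (word (k * M + k - 1, a \<circ> interval_proj k))
          (word (k * M + k - 1, b \<circ> interval_proj l))"
        using nudges word_interval_proj[OF kl(1), of M a] word_interval_proj[OF kl(2), of N b]
        by (simp only: ab len)
      show "loop_word Y y0 (word (k * M + k - 1, a \<circ> interval_proj k))"
        using loop word_interval_proj[OF kl(1), of M a] by (simp only: ab)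
    qed
    with kl show ?hom by blast
  qed
  then show ?thesis using ab by (auto simp: subdiv_loop_rel_def)
qed


section \<open>Projections with simply connected fibres\<close>

definition loop_injective :: "('b \<Rightarrow> 'a) \<Rightarrow> 'b::tolerance set \<Rightarrow> 'b \<Rightarrow> 'a::tolerance set \<Rightarrow> bool" where
  "loop_injective f Z z0 Y \<longleftrightarrow>
     (\<forall>ps qs. loop_word Z z0 ps \<longrightarrow> loop_word Z z0 qs \<longrightarrow> edge_equiv Y (map f ps) (map f qs) \<longrightarrow>
        edge_equiv Z ps qs)"

definition loop_surjective ::
    "('b \<Rightarrow> 'a) \<Rightarrow> 'b::tolerance set \<Rightarrow> 'b \<Rightarrow> 'a::tolerance set \<Rightarrow> 'a \<Rightarrow> bool" where
  "loop_surjective f Z z0 Y y0 \<longleftrightarrow>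
     (\<forall>xs. loop_word Y y0 xs \<longrightarrow> (\<exists>ps. loop_word Z z0 ps \<and> edge_equiv Y (map f ps) xs))"

text \<open>
  The preimages of cliques are required to be simply connected in \<open>Z\<close> only: the homotopy
  between two paths over a clique may leave the preimage of the clique.
\<close>

locale simply_connected_fibres =
  fixes Z :: "'b::tolerance set" and X :: "'a::tolerance set" and \<rho> :: "'b \<Rightarrow> 'a" and c :: "'a \<Rightarrow> 'b"
  assumes cont: "digital_continuous Z X \<rho>"
    and section_in: "x \<in> X \<Longrightarrow> c x \<in> Z"
    and section_eq: "x \<in> X \<Longrightarrow> \<rho> (c x) = x"
    and fibre_connected: "clique C \<Longrightarrow> C \<subseteq> X \<Longrightarrow> p \<in> Z \<Longrightarrow> q \<in> Z \<Longrightarrow> \<rho> p \<in> C \<Longrightarrow> \<rho> q \<in> C \<Longrightarrow>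
      \<exists>ps. edge_path {z \<in> Z. \<rho> z \<in> C} ps \<and> hd ps = p \<and> last ps = q"
    and fibre_simply_connected: "clique C \<Longrightarrow> C \<subseteq> X \<Longrightarrow>
      edge_path {z \<in> Z. \<rho> z \<in> C} ps \<Longrightarrow> edge_path {z \<in> Z. \<rho> z \<in> C} qs \<Longrightarrow>
      hd ps = hd qs \<Longrightarrow> last ps = last qs \<Longrightarrow> edge_equiv Z ps qs"
begin

text \<open>
  The choice does not matter up to \<open>edge_equiv\<close>, since the preimage of an edge is simply connected.
\<close>

definition join :: "'b \<Rightarrow> 'b \<Rightarrow> 'b list" where
  "join p q = (SOME ps. edge_path {z \<in> Z. \<rho> z \<in> {\<rho> p, \<rho> q}} ps \<and> hd ps = p \<and> last ps = q)"

lemma rho_in: "p \<in> Z \<Longrightarrow> \<rho> p \<in> X"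
  and rho_adjacent: "p \<in> Z \<Longrightarrow> q \<in> Z \<Longrightarrow> adjacent p q \<Longrightarrow> adjacent (\<rho> p) (\<rho> q)"
  using cont by (auto simp: digital_continuous_def)

lemma join:
  assumes "p \<in> Z" "q \<in> Z" "adjacent (\<rho> p) (\<rho> q)"
  shows "edge_path {z \<in> Z. \<rho> z \<in> {\<rho> p, \<rho> q}} (join p q)" "hd (join p q) = p" "last (join p q) = q"
proof -
  have "clique {\<rho> p, \<rho> q}" using assms(3) by (rule clique_pair)
  then have "\<exists>ps. edge_path {z \<in> Z. \<rho> z \<in> {\<rho> p, \<rho> q}} ps \<and> hd ps = p \<and> last ps = q"
    using assms rho_in by (intro fibre_connected) auto
  from someI_ex[OF this]
  show "edge_path {z \<in> Z. \<rho> z \<in> {\<rho> p, \<rho> q}} (join p q)" "hd (join p q) = p" "last (join p q) = q"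
    by (auto simp: join_def)
qed

lemma join_over:
  assumes "p \<in> Z" "q \<in> Z" "adjacent (\<rho> p) (\<rho> q)" "\<rho> p \<in> C" "\<rho> q \<in> C"
  shows "edge_path {z \<in> Z. \<rho> z \<in> C} (join p q)"
  using join(1)[OF assms(1-3)] by (rule edge_path_mono) (use assms in auto)

lemma join_neq_Nil: "p \<in> Z \<Longrightarrow> q \<in> Z \<Longrightarrow> adjacent (\<rho> p) (\<rho> q) \<Longrightarrow> join p q \<noteq> []"
  using join(1) by fastforce

lemma join_self: "p \<in> Z \<Longrightarrow> edge_equiv Z (join p p) [p]"
  using join[of p p] join_over[of p p "{\<rho> p}"] rho_in
  by (intro fibre_simply_connected[of "{\<rho> p}"]) (auto simp: clique_def edge_path_Cons)

lemma edge_path_join: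
  assumes "p \<in> Z" "q \<in> Z" "adjacent (\<rho> p) (\<rho> q)"
  shows "edge_path Z (join p q)"
  using join(1)[OF assms] by (rule edge_path_mono) auto

fun lift :: "'a list \<Rightarrow> 'b list" where
  "lift [] = []"
| "lift [a] = [c a]"
| "lift (a # b # xs) = join (c a) (c b) @ lift (b # xs)"

lemma lift_props:
  "edge_path X xs \<Longrightarrow> edge_path Z (lift xs) \<and> hd (lift xs) = c (hd xs) \<and> last (lift xs) = c (last xs)"
proof (induction xs rule: lift.induct)
  case (2 a)
  then show ?case using section_in by (auto simp: edge_path_Cons)
next
  case (3 a b xs)
  then have ab: "edge_path X (b # xs)" "c a \<in> Z" "c b \<in> Z" "adjacent (\<rho> (c a)) (\<rho> (c b))"
    using section_in section_eq by (auto simp: edge_path_Cons)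
  then have IH: "edge_path Z (lift (b # xs))" "hd (lift (b # xs)) = c b"
    "last (lift (b # xs)) = c (last (b # xs))" using 3 by auto
  then have "lift (b # xs) \<noteq> []" by auto
  then show ?case
    using IH join[OF ab(2-4)] join_neq_Nil[OF ab(2-4)] edge_path_join[OF ab(2-4)]
    by (simp add: edge_path_append)
qed simp

lemma lift_append_cong:
  "edge_equiv Z (lift (a # v)) (lift (a # w)) \<Longrightarrow> edge_path X (u @ a # v) \<Longrightarrow>
     edge_equiv Z (lift (u @ a # v)) (lift (u @ a # w))"
proof (induction u)
  case (Cons d u)
  obtain e r s where e: "u @ a # v = e # r" "u @ a # w = e # s"
    by (cases u) auto
  have "edge_path X (u @ a # v)" using Cons.prems by (auto simp: edge_path_Cons)
  then have "edge_equiv Z (lift (e # r)) (lift (e # s))" using Cons e by simp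
  then show ?case
    using edge_equiv_context[of Z "lift (e # r)" "lift (e # s)" "join (c d) (c e)" "[]"]
      lift_props[OF Cons.prems(2)] by (simp add: e)
qed simp

text \<open>
  Over a triangle, the lifts of one side and of the other two sides lie in a common simply connected
  preimage.
\<close>

lemma edge_equiv_lift:
  assumes "edge_equiv X xs ys"
  shows "edge_equiv Z (lift xs) (lift ys)"
  using assms
proof (induction rule: edge_equiv.induct)
  case (refl xs)
  then show ?case using lift_props edge_equiv.refl by blast
next
  case (repeat u a v)
  have path: "edge_path X (a # v)"
    using repeat by (cases "u = []") (auto simp: edge_path_append)
  then have a: "c a \<in> Z" using section_in by (simp add: edge_path_Cons)
  have lp: "edge_path Z (lift (a # v))" "hd (lift (a # v)) = c a"
    using lift_props[OF path] by auto
  have "edge_path X (a # a # v)" using path by (auto simp: edge_path_Cons)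
  then have "edge_path Z (join (c a) (c a) @ lift (a # v))" using lift_props by fastforce
  then have "edge_equiv Z (join (c a) (c a) @ lift (a # v)) ([c a] @ lift (a # v))"
    using edge_equiv_context[OF join_self[OF a], of "[]"] by simp
  moreover have "edge_equiv Z (lift (a # v)) ([c a] @ lift (a # v))"
    using edge_equiv_repeat_hd[OF lp(1), of 1] lp(2) by simp
  ultimately have "edge_equiv Z (lift (a # v)) (lift (a # a # v))"
    by (auto intro: edge_equiv.trans edge_equiv.sym)
  then show ?case using repeat by (rule lift_append_cong)
next
  case (triangle u a b v x)
  have path: "edge_path X (a # b # v)"
    using triangle(1) by (cases "u = []") (auto simp: edge_path_append)
  then have abx: "a \<in> X" "b \<in> X" "x \<in> X" "adjacent a b" "adjacent a x" "adjacent x b"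
    using triangle by (auto simp: edge_path_Cons)
  have cs: "c a \<in> Z" "c b \<in> Z" "c x \<in> Z" "\<rho> (c a) = a" "\<rho> (c b) = b" "\<rho> (c x) = x"
    using abx section_in section_eq by auto
  let ?C = "{a, x, b}"
  have "clique ?C" using abx by (auto simp: clique_def adjacent_sym)
  moreover have "edge_path {z \<in> Z. \<rho> z \<in> ?C} (join (c a) (c b))"
    using abx cs by (intro join_over) auto
  moreover have "edge_path {z \<in> Z. \<rho> z \<in> ?C} (join (c a) (c x))"
    "edge_path {z \<in> Z. \<rho> z \<in> ?C} (join (c x) (c b))"
    using abx cs by (intro join_over; simp)+
  ultimately have "edge_equiv Z (join (c a) (c b)) (join (c a) (c x) @ join (c x) (c b))"
    using abx cs join join_neq_Nil
    by (intro fibre_simply_connected[of ?C]) (auto simp: edge_path_append)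
  then have "edge_equiv Z (lift (a # b # v)) (lift (a # x # b # v))"
    using edge_equiv_context[of Z _ _ "[]" "lift (b # v)"] lift_props[OF path] by fastforce
  then show ?case using triangle(1) by (rule lift_append_cong)
qed (blast intro: edge_equiv.sym edge_equiv.trans)+

text \<open>
  The joins from the section points \<open>c (\<rho> p)\<close> to the points \<open>p\<close> of the path are the rungs of a ladder
  between the path and the lift of its image; each square of the ladder lies over an edge.
\<close>

lemma lift_projection:
  assumes "edge_path Z ps"
  shows "edge_equiv Z (join (c (\<rho> (hd ps))) (hd ps) @ ps)
      (lift (map \<rho> ps) @ join (c (\<rho> (last ps))) (last ps))"
  using assms
proof (induction ps)
  case (Cons p ps)
  have p: "p \<in> Z" "\<rho> p \<in> X" "c (\<rho> p) \<in> Z" "\<rho> (c (\<rho> p)) = \<rho> p"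
    using Cons.prems section_in section_eq rho_in by (auto simp: edge_path_Cons)
  note jp = join[of "c (\<rho> p)" p] join_neq_Nil[of "c (\<rho> p)" p] join_over[of "c (\<rho> p)" p]
  show ?case
  proof (cases ps)
    case Nil
    have "edge_equiv Z (join (c (\<rho> p)) p @ [p]) (c (\<rho> p) # join (c (\<rho> p)) p)"
      using jp p by (intro fibre_simply_connected[of "{\<rho> p}"])
        (auto simp: edge_path_Cons edge_path_append clique_def)
    then show ?thesis using Nil by simp
  next
    case (Cons q qs)
    have ps: "edge_path Z ps" "adjacent p q" "edge_path Z (q # qs)"
      using Cons.prems Cons by (auto simp: edge_path_Cons)
    have q: "q \<in> Z" "\<rho> q \<in> X" "c (\<rho> q) \<in> Z" "\<rho> (c (\<rho> q)) = \<rho> q" "adjacent (\<rho> p) (\<rho> q)"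
      using ps Cons p section_in section_eq rho_in rho_adjacent by (auto simp: edge_path_Cons)
    note jq = join[of "c (\<rho> q)" q] join_neq_Nil[of "c (\<rho> q)" q] join_over[of "c (\<rho> q)" q]
    note jpq = join[of "c (\<rho> p)" "c (\<rho> q)"] join_neq_Nil[of "c (\<rho> p)" "c (\<rho> q)"]
      join_over[of "c (\<rho> p)" "c (\<rho> q)"]
    let ?C = "{\<rho> p, \<rho> q}"
    let ?J = "join (c (\<rho> p)) (c (\<rho> q))"
    define tail where "tail = lift (map \<rho> ps) @ join (c (\<rho> (last ps))) (last ps)"
    have IH: "edge_equiv Z (join (c (\<rho> q)) q @ ps) tail"
      using Cons.IH[OF ps(1)] Cons by (simp add: tail_def)
    \<comment> \<open>Both paths run from the centre over \<open>\<rho> p\<close> to \<open>q\<close> above the edge from \<open>\<rho> p\<close> to \<open>\<rho> q\<close>.\<close>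
    have square: "edge_equiv Z (join (c (\<rho> p)) p @ [p, q]) (?J @ join (c (\<rho> q)) q @ [q])"
    proof (rule fibre_simply_connected[of ?C])
      show "clique ?C" using q(5) by (rule clique_pair)
      show "edge_path {z \<in> Z. \<rho> z \<in> ?C} (join (c (\<rho> p)) p @ [p, q])"
        using p q ps jp(1-4) jp(5)[of ?C] by (simp add: edge_path_append edge_path_Cons)
      show "edge_path {z \<in> Z. \<rho> z \<in> ?C} (?J @ join (c (\<rho> q)) q @ [q])"
        using p q ps jq(1-4) jq(5)[of ?C] jpq by (simp add: edge_path_append edge_path_Cons)
    qed (use p q jp jq jpq in auto)
    have path1: "edge_path Z ((join (c (\<rho> p)) p @ [p, q]) @ ps)"
      using square[THEN edge_equiv_props] ps Cons
        edge_path_append[of "join (c (\<rho> p)) p @ [p, q]" ps Z] by simp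
    have "edge_equiv Z (join (c (\<rho> p)) p @ p # ps) ((join (c (\<rho> p)) p @ [p, q]) @ ps)"
      using edge_equiv.repeat[of Z "join (c (\<rho> p)) p @ [p]" q qs] jp p q ps Cons Cons.prems
      using edge_path_join by (simp add: edge_path_append)
    also have "edge_equiv Z \<dots> ((?J @ join (c (\<rho> q)) q @ [q]) @ ps)"
      using edge_equiv_append[OF square edge_equiv.refl[OF ps(1)] path1] .
    also have "edge_equiv Z \<dots> (?J @ join (c (\<rho> q)) q @ ps)"
    proof -
      have "edge_path Z (?J @ join (c (\<rho> q)) q @ q # qs)"
        using jpq jq p q ps edge_path_join by (simp add: edge_path_append)
      then show ?thesis
        using edge_equiv.sym[OF edge_equiv.repeat[of Z "?J @ join (c (\<rho> q)) q" q qs]] Cons by simp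
    qed
    also have "edge_equiv Z \<dots> (?J @ tail)"
    proof -
      have "edge_path Z (?J @ join (c (\<rho> q)) q @ ps)"
        using jpq jq p q ps Cons edge_path_join by (simp add: edge_path_append)
      then show ?thesis
        using edge_equiv_context[OF IH, of ?J "[]"] by simp
    qed
    also have "?J @ tail = lift (map \<rho> (p # ps)) @ join (c (\<rho> (last (p # ps)))) (last (p # ps))"
      using Cons by (simp add: tail_def)
    finally show ?thesis by simp
  qed
qed simp

lemma projection_lift:
  "edge_path X xs \<Longrightarrow> edge_equiv X (map \<rho> (lift xs)) xs"
proof (induction xs rule: lift.induct)
  case (2 a)
  then show ?case using section_eq by (auto simp: edge_path_Cons intro: edge_equiv.refl)
next
  case (3 a b xs)
  then have ab: "a \<in> X" "b \<in> X" "adjacent a b" and path: "edge_path X (b # xs)"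
    by (auto simp: edge_path_Cons)
  then have cs: "c a \<in> Z" "c b \<in> Z" "\<rho> (c a) = a" "\<rho> (c b) = b"
    using section_in section_eq by auto
  then have j: "edge_path {z \<in> Z. \<rho> z \<in> {a, b}} (join (c a) (c b))"
    "hd (join (c a) (c b)) = c a" "last (join (c a) (c b)) = c b" "join (c a) (c b) \<noteq> []"
    using join[of "c a" "c b"] join_neq_Nil ab by auto
  have "digital_continuous {z \<in> Z. \<rho> z \<in> {a, b}} {a, b} \<rho>"
    using cont by (auto simp: digital_continuous_def)
  from edge_path_map[OF j(1) this]
  have "edge_equiv X (map \<rho> (join (c a) (c b))) [a, b]"
    using edge_equiv_clique[of "{a, b}" "map \<rho> (join (c a) (c b))" X] clique_pair[OF ab(3)] j ab cs
    by (simp add: hd_map last_map)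
  moreover have "edge_path X (map \<rho> (lift (a # b # xs)))"
    using edge_path_map[OF _ cont] lift_props[OF 3(2)] by blast
  ultimately have "edge_equiv X (map \<rho> (lift (a # b # xs))) ([a, b] @ b # xs)"
    using edge_equiv_append[of X _ "[a, b]", OF _ 3(1)[OF path]] by simp
  also have "edge_equiv X \<dots> (a # b # xs)"
    using edge_equiv.repeat[of X "[a]" b xs] 3(2) by (auto intro: edge_equiv.sym)
  finally show ?case .
qed simp

text \<open>
  A loop at \<open>c x0\<close> is equivalent to the lift of its image, and lifting preserves equivalence.
\<close>

theorem loop_injective_projection:
  assumes "x0 \<in> X"
  shows "loop_injective \<rho> Z (c x0) X"
  unfolding loop_injective_def
proof (intro allI impI)
  fix ps qs
  assume loops: "loop_word Z (c x0) ps" "loop_word Z (c x0) qs"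
    and equiv: "edge_equiv X (map \<rho> ps) (map \<rho> qs)"
  let ?z = "c x0"
  have z: "?z \<in> Z" "\<rho> ?z = x0" using assms section_in section_eq by auto
  have closed: "edge_equiv Z rs (lift (map \<rho> rs))" if "loop_word Z ?z rs" for rs
  proof -
    have rs: "edge_path Z rs" "hd rs = ?z" "last rs = ?z" using that by (auto simp: loop_word_def)
    then have ne: "rs \<noteq> []" by auto
    let ?L = "lift (map \<rho> rs)"
    have L: "edge_path Z ?L" "hd ?L = ?z" "last ?L = ?z"
      using lift_props[OF edge_path_map[OF rs(1) cont]] rs ne z by (auto simp: hd_map last_map)
    have jz: "edge_path Z (join ?z ?z)" "hd (join ?z ?z) = ?z" "last (join ?z ?z) = ?z"
      "join ?z ?z \<noteq> []"
      using edge_path_join join join_neq_Nil z by auto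
    have Lne: "?L \<noteq> []" using L by auto
    have "edge_equiv Z rs ([?z] @ rs)"
      using edge_equiv_repeat_hd[OF rs(1), of 1] rs by simp
    also have "edge_equiv Z \<dots> (join ?z ?z @ rs)"
      using jz rs ne by (intro edge_equiv.sym[OF edge_equiv_append[OF join_self[OF z(1)]]])
        (auto simp: edge_path_append intro: edge_equiv.refl)
    also have "edge_equiv Z \<dots> (?L @ join ?z ?z)"
      using lift_projection[OF rs(1)] rs z by simp
    also have "edge_equiv Z \<dots> (?L @ [?z])"
      using jz L Lne by (intro edge_equiv_append[OF _ join_self[OF z(1)]])
        (auto simp: edge_path_append intro: edge_equiv.refl)
    also have "edge_equiv Z \<dots> ?L"
      using edge_equiv_repeat_last[OF L(1)] L by (simp add: edge_equiv.sym)
    finally show ?thesis .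
  qed
  show "edge_equiv Z ps qs"
    using closed[OF loops(1)] closed[OF loops(2)] edge_equiv_lift[OF equiv]
    by (blast intro: edge_equiv.trans edge_equiv.sym)
qed

theorem loop_surjective_projection:
  shows "loop_surjective \<rho> Z (c x0) X x0"
  unfolding loop_surjective_def
proof (intro allI impI)
  fix xs assume "loop_word X x0 xs"
  then have "loop_word Z (c x0) (lift xs)" "edge_equiv X (map \<rho> (lift xs)) xs"
    using lift_props projection_lift by (auto simp: loop_word_def)
  then show "\<exists>ps. loop_word Z (c x0) ps \<and> edge_equiv X (map \<rho> ps) xs" by blast
qed

end


section \<open>Subdivision\<close>

lemma adjacent_vec_iff: "adjacent (x :: int ^ 'n) y \<longleftrightarrow> (\<forall>i. \<bar>x $ i - y $ i\<bar> \<le> 1)"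
  by (simp add: adjacent_vec_def adjacent_int_def)

lemma std_proj_1: "std_proj 1 y = y"
  by (simp add: std_proj_def vec_eq_iff)

lemma std_proj_std_proj: "std_proj k (std_proj l y) = std_proj (k * l) y"
  by (simp add: std_proj_def vec_eq_iff zdiv_zmult2_eq[symmetric] mult.commute)

lemma subdivision_1: "subdivision X 1 = X"
  by (simp add: subdivision_def std_proj_1 del: One_nat_def)

lemma subdiv_base_1: "subdiv_base 1 x = x"
  by (simp add: subdiv_base_def vec_eq_iff)

lemma div_adjacent:
  fixes u v k :: int
  assumes "\<bar>u - v\<bar> \<le> 1" "0 < k"
  shows "\<bar>u div k - v div k\<bar> \<le> 1"
proof -
  have "a div k \<le> b div k + 1" if "a \<le> b + 1" for a b :: int
  proof -
    have "a div k \<le> (b + k * 1) div k" using that assms(2) by (intro zdiv_mono1) auto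
    also have "\<dots> = b div k + 1" using assms(2) by (subst div_mult_self2) auto
    finally show ?thesis .
  qed
  from this[of u v] this[of v u] assms(1) show ?thesis by linarith
qed

lemma std_proj_adjacent:
  "1 \<le> k \<Longrightarrow> adjacent x y \<Longrightarrow> adjacent (std_proj k x) (std_proj k y)"
  by (simp add: adjacent_vec_iff std_proj_def div_adjacent)

lemma std_proj_continuous:
  assumes "1 \<le> k"
  shows "digital_continuous (subdivision X (l * k)) (subdivision X l) (std_proj k)"
  using assms by (auto simp: digital_continuous_def subdivision_def std_proj_std_proj std_proj_adjacent)

text \<open>
  Projections between subdivisions preserve base points because
  \<open>(k l - 1) div 2 div l = (k l - 1) div l div 2 = (k - 1) div 2\<close>.
\<close>

lemma std_proj_subdiv_base:
  assumes "1 \<le> l" "1 \<le> k"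
  shows "std_proj l (subdiv_base (k * l) x) = subdiv_base k x"
proof -
  have "(int k * int l * a + (int k * int l - 1) div 2) div int l = int k * a + (int k - 1) div 2"
    for a
  proof -
    have l: "0 < int l" using assms by simp
    have "(int k * int l - 1) div 2 div int l = (int k * int l - 1) div (2 * int l)"
      by (simp add: zdiv_zmult2_eq)
    also have "\<dots> = (int k * int l - 1) div int l div 2"
      using zdiv_zmult2_eq[of 2 "int k * int l - 1" "int l"] by (simp add: mult.commute)
    also have "(int k * int l - 1) div int l = int k - 1"
      by (rule int_div_pos_eq[where r = "int l - 1"]) (use l in \<open>auto simp: algebra_simps\<close>)
    finally have half: "(int k * int l - 1) div 2 div int l = (int k - 1) div 2" .
    have "int k * int l * a + (int k * int l - 1) div 2 =
        (int k * int l - 1) div 2 + int l * (int k * a)" by simp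
    then show ?thesis using l half by (simp only: div_mult_self2)
  qed
  then show ?thesis by (simp add: vec_eq_iff std_proj_def subdiv_base_def)
qed

text \<open>
  The two middle layers of the box over \<open>b + {0, 1}\<^sup>n\<close> are \<open>k b + k - 1\<close> and \<open>k b + k\<close> in each
  coordinate. They lie in different blocks, which is why clamping to \<open>j\<close> further layers on either
  side of them never moves a point to another block. The parameter \<open>j\<close> runs from \<open>k - 1\<close>, where nothing is
  clamped, down to \<open>0\<close>, where only the corners of a unit cube are left.
\<close>

definition squeeze :: "nat \<Rightarrow> int ^ 'n \<Rightarrow> nat \<Rightarrow> int ^ 'n \<Rightarrow> int ^ 'n" where
  "squeeze k b j y = (\<chi> i. max (int k * b $ i + int k - 1 - int j) (min (int k * b $ i + int k + int j) (y $ i)))"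

text \<open>
  Coordinatewise, the values differ by at most one from each other, not only from a chosen point
  \<open>z\<close>; so below \<open>z\<close> and above \<open>z\<close> cannot both occur.
\<close>

lemma clique_in_unit_cube:
  fixes C :: "(int ^ 'n) set"
  assumes "clique C"
  obtains b where "\<And>x i. x \<in> C \<Longrightarrow> x $ i = b $ i \<or> x $ i = b $ i + 1"
proof (cases "C = {}")
  case False
  then obtain z where z: "z \<in> C" by blast
  define b :: "int ^ 'n" where "b = (\<chi> i. if \<exists>x\<in>C. x $ i = z $ i - 1 then z $ i - 1 else z $ i)"
  have "x $ i = b $ i \<or> x $ i = b $ i + 1" if x: "x \<in> C" for x i
  proof -
    have near: "\<bar>x $ i - y $ i\<bar> \<le> 1" if "y \<in> C" for y
      using assms x that by (auto simp: clique_def adjacent_vec_iff)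
    show ?thesis
    proof (cases "\<exists>y\<in>C. y $ i = z $ i - 1")
      case True
      then obtain y where y: "y \<in> C" "y $ i = z $ i - 1" by blast
      then have "b $ i = z $ i - 1" unfolding b_def by auto
      then show ?thesis using near[OF y(1)] near[OF z] y(2) by linarith
    next
      case False
      then have "x $ i \<noteq> z $ i - 1" "b $ i = z $ i" using x unfolding b_def by auto
      then show ?thesis using near[OF z] by linarith
    qed
  qed
  then show ?thesis using that by blast
qed (use that in blast)

context
  fixes k :: nat and X C :: "(int ^ 'n) set" and b :: "int ^ 'n" and A :: "(int ^ 'n) set"
  assumes k: "1 \<le> k" and C: "C \<subseteq> X"
    and cube: "\<And>x i. x \<in> C \<Longrightarrow> x $ i = b $ i \<or> x $ i = b $ i + 1"
  defines "A \<equiv> {z \<in> subdivision X k. std_proj k z \<in> C}"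
begin

lemma fibre_bounds:
  assumes "z \<in> A"
  shows "int k * b $ i \<le> z $ i" "z $ i < int k * b $ i + 2 * int k"
proof -
  have "z $ i div int k = b $ i \<or> z $ i div int k = b $ i + 1"
    using assms cube[of "std_proj k z" i] by (auto simp: A_def std_proj_def)
  then have "int k * (z $ i div int k) = int k * b $ i \<or>
      int k * (z $ i div int k) = int k * b $ i + int k"
    by (auto simp: distrib_left)
  moreover have "int k * (z $ i div int k) + z $ i mod int k = z $ i" by simp
  moreover have "0 \<le> z $ i mod int k" "z $ i mod int k < int k" using k by auto
  ultimately show "int k * b $ i \<le> z $ i" "z $ i < int k * b $ i + 2 * int k"
    by linarith+
qed

lemma squeeze_std_proj:
  assumes "z \<in> A"
  shows "std_proj k (squeeze k b j z) = std_proj k z"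
proof -
  have "squeeze k b j z $ i div int k = z $ i div int k" for i
  proof -
    let ?m = "int k * b $ i" and ?s = "squeeze k b j z $ i"
    have block: "v div int k = c" if "int k * c \<le> v" "v < int k * c + int k" for v c
      by (rule int_div_pos_eq[where r = "v - int k * c"]) (use that in auto)
    note bounds = fibre_bounds[OF assms, of i]
    show ?thesis
    proof (cases "z $ i < ?m + int k")
      case True
      then have "?m \<le> ?s" "?s < ?m + int k" using bounds by (auto simp: squeeze_def)
      then show ?thesis using block[of "b $ i"] True bounds by simp
    next
      case False
      then have "?m + int k \<le> ?s" "?s < ?m + 2 * int k" using bounds by (auto simp: squeeze_def)
      then show ?thesis using block[of "b $ i + 1"] False bounds by (simp add: distrib_left)
    qed
  qed
  then show ?thesis by (simp add: std_proj_def vec_eq_iff)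
qed

lemma squeeze_in: "z \<in> A \<Longrightarrow> squeeze k b j z \<in> A"
  using squeeze_std_proj by (auto simp: A_def subdivision_def)

text \<open>
  The second part makes consecutive stages the two sides of a prism: clamping to \<open>j + 1\<close> layers
  moves a coordinate differently from clamping to \<open>j\<close> only when it lies outside the inner layers, and
  then the coordinate of an adjacent point is clamped to the boundary of the inner layers.
\<close>

lemma squeeze_adjacent:
  assumes "adjacent y z"
  shows "adjacent (squeeze k b j y) (squeeze k b j z)"
    and "adjacent (squeeze k b (Suc j) y) (squeeze k b j z)"
proof -
  have "\<bar>max lo (min hi u) - max lo (min hi v)\<bar> \<le> 1"
    "\<bar>max (lo - 1) (min (hi + 1) u) - max lo (min hi v)\<bar> \<le> 1"
    if "\<bar>u - v\<bar> \<le> 1" for lo hi u v :: int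
    using that by linarith+
  note lipschitz = this
  have yz: "\<bar>y $ i - z $ i\<bar> \<le> 1" for i using assms by (simp add: adjacent_vec_iff)
  have suc: "squeeze k b (Suc j) y $ i =
      max (int k * b $ i + int k - 1 - int j - 1) (min (int k * b $ i + int k + int j + 1) (y $ i))" for i
    by (simp add: squeeze_def algebra_simps)
  show "adjacent (squeeze k b j y) (squeeze k b j z)"
    using lipschitz(1)[OF yz] by (simp add: adjacent_vec_iff squeeze_def)
  show "adjacent (squeeze k b (Suc j) y) (squeeze k b j z)"
    unfolding adjacent_vec_iff suc
    by (simp only: squeeze_def vec_lambda_beta) (intro allI lipschitz(2)[OF yz])
qed

lemma squeeze_continuous: "digital_continuous A A (squeeze k b j)"
  using squeeze_in squeeze_adjacent(1) by (auto simp: digital_continuous_def)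

lemma squeeze_start: "z \<in> A \<Longrightarrow> squeeze k b (k - 1) z = z"
proof -
  assume z: "z \<in> A"
  have "squeeze k b (k - 1) z $ i = z $ i" for i
    using fibre_bounds[OF z, of i] k by (simp add: squeeze_def of_nat_diff)
  then show "squeeze k b (k - 1) z = z" by (simp add: vec_eq_iff)
qed

lemma squeeze_end: "clique (squeeze k b 0 ` A)"
  by (auto simp: clique_def adjacent_vec_iff squeeze_def)

lemma squeeze_connected:
  assumes "p \<in> A" "q \<in> A"
  shows "\<exists>ps. edge_path A ps \<and> hd ps = squeeze k b j p \<and> last ps = squeeze k b j q"
proof (induction j)
  case 0
  have "edge_path A [squeeze k b 0 p, squeeze k b 0 q]"
    using squeeze_end assms squeeze_in by (auto simp: edge_path_Cons clique_def)
  then show ?case by (intro exI[of _ "[squeeze k b 0 p, squeeze k b 0 q]"]) simp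
next
  case (Suc j)
  then obtain ps where ps: "edge_path A ps" "hd ps = squeeze k b j p" "last ps = squeeze k b j q"
    by blast
  have "edge_path A (squeeze k b (Suc j) p # ps @ [squeeze k b (Suc j) q])"
    using ps assms squeeze_in squeeze_adjacent(2)[of p p j]
      adjacent_sym[OF squeeze_adjacent(2)[of q q j]]
    by (cases "ps = []") (auto simp: edge_path_Cons edge_path_append)
  then show ?case
    by (intro exI[of _ "squeeze k b (Suc j) p # ps @ [squeeze k b (Suc j) q]"]) simp
qed

text \<open>
  At stage \<open>0\<close> both paths lie in a clique. Going from stage \<open>j\<close> to \<open>j + 1\<close> conjugates both by the same
  two edges, given by their common end points.
\<close>

lemma squeeze_simply_connected:
  assumes "edge_path A ps" "edge_path A qs" "hd ps = hd qs" "last ps = last qs"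
  shows "edge_equiv A (map (squeeze k b j) ps) (map (squeeze k b j) qs)"
proof (induction j)
  case 0
  have ne: "ps \<noteq> []" "qs \<noteq> []" using assms by auto
  have "edge_equiv A (map (squeeze k b 0) rs) [squeeze k b 0 (hd rs), squeeze k b 0 (last rs)]"
    if "edge_path A rs" for rs
  proof -
    have "edge_path (squeeze k b 0 ` A) (map (squeeze k b 0) rs)"
      using squeeze_adjacent(1)
      by (intro edge_path_map[OF that]) (auto simp: digital_continuous_def)
    moreover have "squeeze k b 0 ` A \<subseteq> A" using squeeze_in by blast
    moreover have "rs \<noteq> []" using that by auto
    ultimately show ?thesis
      using edge_equiv_clique[of "squeeze k b 0 ` A" "map (squeeze k b 0) rs" A] squeeze_end
      by (simp add: hd_map last_map)
  qed
  from edge_equiv.trans[OF this[OF assms(1)] edge_equiv.sym[OF this[OF assms(2), folded assms(3,4)]]]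
  show ?case .
next
  case (Suc j)
  have prism: "edge_equiv A (map (squeeze k b (Suc j)) rs)
      ([squeeze k b (Suc j) (hd rs)] @ map (squeeze k b j) rs @ [squeeze k b (Suc j) (last rs)])"
    if "edge_path A rs" for rs
    using edge_equiv_prism[OF that squeeze_continuous squeeze_continuous squeeze_adjacent(2)] by simp
  have "edge_equiv A
      ([squeeze k b (Suc j) (hd ps)] @ map (squeeze k b j) ps @ [squeeze k b (Suc j) (last ps)])
      ([squeeze k b (Suc j) (hd ps)] @ map (squeeze k b j) qs @ [squeeze k b (Suc j) (last ps)])"
    using edge_equiv_props[OF prism[OF assms(1)]] by (intro edge_equiv_context[OF Suc]) blast
  from edge_equiv.trans[OF edge_equiv.trans[OF prism[OF assms(1)] this]
      edge_equiv.sym[OF prism[OF assms(2), folded assms(3,4)]]]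
  show ?case .
qed

end

lemma edge_equiv_mono: "edge_equiv A xs ys \<Longrightarrow> A \<subseteq> B \<Longrightarrow> edge_equiv B xs ys"
  using edge_equiv_map[of A xs ys B "\<lambda>x. x"] by (auto simp: digital_continuous_def)

lemma std_proj_simply_connected_fibres:
  fixes X :: "(int ^ 'n) set"
  assumes k: "1 \<le> k"
  shows "simply_connected_fibres (subdivision X k) X (std_proj k) (subdiv_base k)"
proof
  show "digital_continuous (subdivision X k) X (std_proj k)"
    using std_proj_continuous[OF k, of X 1] by (simp add: subdivision_1 del: One_nat_def)
  have c: "std_proj k (subdiv_base k x) = x" for x :: "int ^ 'n"
    using std_proj_subdiv_base[of k 1 x] k by (simp add: subdiv_base_1 del: One_nat_def)
  then show "subdiv_base k x \<in> subdivision X k" if "x \<in> X" for x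
    using that by (simp add: subdivision_def)
  show "std_proj k (subdiv_base k x) = x" for x :: "int ^ 'n" by (rule c)
next
  fix C :: "(int ^ 'n) set" and p q
  let ?A = "{z \<in> subdivision X k. std_proj k z \<in> C}"
  assume C: "clique C" "C \<subseteq> X" and pq: "p \<in> subdivision X k" "q \<in> subdivision X k"
    "std_proj k p \<in> C" "std_proj k q \<in> C"
  obtain b where b: "\<And>x i. x \<in> C \<Longrightarrow> x $ i = b $ i \<or> x $ i = b $ i + 1"
    using clique_in_unit_cube[OF C(1)] by blast
  show "\<exists>ps. edge_path ?A ps \<and> hd ps = p \<and> last ps = q"
    using squeeze_connected[OF k C(2) b, of p q "k - 1"] pq squeeze_start[OF k C(2) b] by simp
next
  fix C :: "(int ^ 'n) set" and ps qs
  let ?A = "{z \<in> subdivision X k. std_proj k z \<in> C}"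
  assume C: "clique C" "C \<subseteq> X" and paths: "edge_path ?A ps" "edge_path ?A qs"
    "hd ps = hd qs" "last ps = last qs"
  obtain b where b: "\<And>x i. x \<in> C \<Longrightarrow> x $ i = b $ i \<or> x $ i = b $ i + 1"
    using clique_in_unit_cube[OF C(1)] by blast
  have start: "map (squeeze k b (k - 1)) rs = rs" if "edge_path ?A rs" for rs
    using that squeeze_start[OF k C(2) b] by (intro map_idI) (auto simp: edge_path_def)
  show "edge_equiv (subdivision X k) ps qs"
    using squeeze_simply_connected[OF k C(2) b paths, of "k - 1"] start paths
    by (auto intro: edge_equiv_mono)
qed

text \<open>
  Two out of three: \<open>\<rho>\<^sub>k\<close> and \<open>\<rho>\<^sub>k \<circ> \<rho>\<^sub>l\<close>, the projections of \<open>S(X, k)\<close> and \<open>S(X, k l)\<close> to \<open>X\<close>, are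
  bijective on classes.
\<close>

lemma loop_bijective_std_proj:
  fixes X :: "(int ^ 'n) set"
  assumes "1 \<le> k" "1 \<le> l" "x0 \<in> X"
  shows "loop_injective (std_proj l) (subdivision X (k * l)) (subdiv_base (k * l) x0) (subdivision X k)"
    and "loop_surjective (std_proj l) (subdivision X (k * l)) (subdiv_base (k * l) x0)
      (subdivision X k) (subdiv_base k x0)"
proof -
  have kl: "1 \<le> k * l" using assms by simp
  interpret k: simply_connected_fibres "subdivision X k" X "std_proj k" "subdiv_base k"
    by (rule std_proj_simply_connected_fibres[OF assms(1)])
  interpret kl: simply_connected_fibres "subdivision X (k * l)" X "std_proj (k * l)" "subdiv_base (k * l)"
    by (rule std_proj_simply_connected_fibres[OF kl])
  have map_map: "map (std_proj k) (map (std_proj l) ps) = map (std_proj (k * l)) ps"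
    for ps :: "(int ^ 'n) list"
    by (simp add: std_proj_std_proj)
  have loop_map: "loop_word (subdivision X k) (subdiv_base k x0) (map (std_proj l) ps)"
    if "loop_word (subdivision X (k * l)) (subdiv_base (k * l) x0) ps" for ps
  proof -
    have "ps \<noteq> []" using that by (auto simp: loop_word_def)
    then show ?thesis
      using that edge_path_map[OF _ std_proj_continuous[OF assms(2)]] assms
      by (auto simp: loop_word_def hd_map last_map std_proj_subdiv_base)
  qed
  show "loop_injective (std_proj l) (subdivision X (k * l)) (subdiv_base (k * l) x0) (subdivision X k)"
    unfolding loop_injective_def
  proof (intro allI impI)
    fix ps qs
    assume loops: "loop_word (subdivision X (k * l)) (subdiv_base (k * l) x0) ps"
      "loop_word (subdivision X (k * l)) (subdiv_base (k * l) x0) qs"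
      and "edge_equiv (subdivision X k) (map (std_proj l) ps) (map (std_proj l) qs)"
    then have "edge_equiv X (map (std_proj (k * l)) ps) (map (std_proj (k * l)) qs)"
      using edge_equiv_map[OF _ k.cont] map_map by metis
    then show "edge_equiv (subdivision X (k * l)) ps qs"
      using kl.loop_injective_projection[OF assms(3)] loops by (simp add: loop_injective_def)
  qed
  show "loop_surjective (std_proj l) (subdivision X (k * l)) (subdiv_base (k * l) x0)
      (subdivision X k) (subdiv_base k x0)"
    unfolding loop_surjective_def
  proof (intro allI impI)
    fix xs assume xs: "loop_word (subdivision X k) (subdiv_base k x0) xs"
    then have "xs \<noteq> []" by (auto simp: loop_word_def)
    then have "loop_word X x0 (map (std_proj k) xs)"
      using xs edge_path_map[OF _ k.cont] k.section_eq[OF assms(3)]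
      by (auto simp: loop_word_def hd_map last_map)
    then obtain ps where ps: "loop_word (subdivision X (k * l)) (subdiv_base (k * l) x0) ps"
      "edge_equiv X (map (std_proj (k * l)) ps) (map (std_proj k) xs)"
      using kl.loop_surjective_projection[of x0] by (auto simp: loop_surjective_def)
    then have "edge_equiv (subdivision X k) (map (std_proj l) ps) xs"
      using k.loop_injective_projection[OF assms(3)] loop_map[OF ps(1)] xs map_map[of ps]
      unfolding loop_injective_def by metis
    with ps(1) show "\<exists>ps. loop_word (subdivision X (k * l)) (subdiv_base (k * l) x0) ps \<and>
        edge_equiv (subdivision X k) (map (std_proj l) ps) xs" by blast
  qed
qed

section \<open>Maps and fundamental groups\<close>

lemma loop_word_map:
  assumes "loop_word Z z0 ps" "based_map Z z0 Y y0 f"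
  shows "loop_word Y y0 (map f ps)"
proof -
  have "ps \<noteq> []" using assms by (auto simp: loop_word_def)
  then show ?thesis
    using assms edge_path_map by (auto simp: loop_word_def based_map_def hd_map last_map)
qed

lemma edge_equiv_based_homotopic:
  assumes "based_homotopic X x0 Y y0 f g" "loop_word X x0 ps"
  shows "edge_equiv Y (map f ps) (map g ps)"
proof -
  obtain N H where H: "digital_continuous (X \<times> digital_interval N) Y H"
    and slices: "\<forall>x\<in>X. H (x, 0) = f x \<and> H (x, int N) = g x"
    and ends: "\<forall>t\<in>digital_interval N. H (x0, t) = y0"
    using assms(1) by (auto simp: based_homotopic_def)
  have "edge_equiv Y (map (\<lambda>p. H (p, 0)) ps) (map (\<lambda>p. H (p, int N)) ps)"
    using assms(2) ends by (intro edge_equiv_homotopy[OF H]) (auto simp: loop_word_def)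
  moreover have "map (\<lambda>p. H (p, 0)) ps = map f ps" "map (\<lambda>p. H (p, int N)) ps = map g ps"
    using slices assms(2) by (auto simp: loop_word_def edge_path_def)
  ultimately show ?thesis by simp
qed

lemma equiv_subdiv_loop_rel:
  fixes Y :: "'a::tolerance set"
  shows "equiv (based_loops Y y0) (subdiv_loop_rel Y y0)"
proof (rule equivI)
  show "refl_on (based_loops Y y0) (subdiv_loop_rel Y y0)"
    unfolding refl_on_def subdiv_loop_rel_iff
    by (metis edge_equiv.refl loop_wordD loop_word_def)
  show "sym (subdiv_loop_rel Y y0)"
    unfolding sym_def subdiv_loop_rel_iff by (blast intro: edge_equiv.sym)
  show "trans (subdiv_loop_rel Y y0)"
    unfolding trans_def subdiv_loop_rel_iff by (blast intro: edge_equiv.trans)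
  show "subdiv_loop_rel Y y0 \<subseteq> based_loops Y y0 \<times> based_loops Y y0"
    by (auto simp: subdiv_loop_rel_iff)
qed

abbreviation loop_class :: "'a::adjacency set \<Rightarrow> 'a \<Rightarrow> 'a digital_loop \<Rightarrow> 'a digital_loop set" where
  "loop_class Y y0 \<alpha> \<equiv> subdiv_loop_rel Y y0 `` {\<alpha>}"

lemma loop_class_eq_iff:
  fixes Y :: "'a::tolerance set"
  assumes "\<alpha> \<in> based_loops Y y0" "\<beta> \<in> based_loops Y y0"
  shows "loop_class Y y0 \<alpha> = loop_class Y y0 \<beta> \<longleftrightarrow> edge_equiv Y (word \<alpha>) (word \<beta>)"
  using eq_equiv_class_iff[OF equiv_subdiv_loop_rel assms] assms by (simp add: subdiv_loop_rel_iff)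

lemma word_concat: "word (loop_concat \<alpha> \<beta>) = word \<alpha> @ word \<beta>"
proof (cases \<alpha>; cases \<beta>)
  fix M a N b assume ab: "\<alpha> = (M, a)" "\<beta> = (N, b)"
  show ?thesis
    unfolding ab loop_concat.simps
  proof (rule word_eqI)
    show "length (word (M, a) @ word (N, b)) = Suc (M + N + 1)" by simp
    fix i assume i: "i \<le> M + N + 1"
    show "(word (M, a) @ word (N, b)) ! i =
        (if int i \<le> int M then a (int i) else b (int i - (int M + 1)))"
    proof (cases "i \<le> M")
      case False
      then obtain j where "i = Suc M + j" using less_iff_Suc_add[of M i] by auto
      then show ?thesis using i nth_word[of j N b] by (simp add: nth_append)
    qed (simp add: nth_append nth_word)
  qed
qed

lemma loop_word_append:
  "loop_word Y y0 xs \<Longrightarrow> loop_word Y y0 ys \<Longrightarrow> loop_word Y y0 (xs @ ys)"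
  by (cases "xs = []"; cases "ys = []") (auto simp: loop_word_def edge_path_append)

lemma concat_based_loops:
  fixes Y :: "'a::tolerance set"
  assumes "\<alpha> \<in> based_loops Y y0" "\<beta> \<in> based_loops Y y0"
  shows "loop_concat \<alpha> \<beta> \<in> based_loops Y y0"
proof -
  have "loop_word Y y0 (word (loop_concat \<alpha> \<beta>))"
    using assms by (simp add: word_concat loop_wordD loop_word_append)
  then show ?thesis by (cases \<alpha>; cases \<beta>) (simp add: based_loops_iff)
qed

lemma mult_loop_class:
  fixes Y :: "'a::tolerance set"
  assumes "\<alpha> \<in> based_loops Y y0" "\<beta> \<in> based_loops Y y0"
  shows "loop_class Y y0 \<alpha> \<otimes>\<^bsub>fundamental_group Y y0\<^esub> loop_class Y y0 \<beta> =
    loop_class Y y0 (loop_concat \<alpha> \<beta>)"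
proof -
  have "loop_class Y y0 (loop_concat \<alpha>' \<beta>') = loop_class Y y0 (loop_concat \<alpha> \<beta>)"
    if "\<alpha>' \<in> loop_class Y y0 \<alpha>" "\<beta>' \<in> loop_class Y y0 \<beta>" for \<alpha>' \<beta>'
  proof -
    have loops: "\<alpha>' \<in> based_loops Y y0" "\<beta>' \<in> based_loops Y y0"
      and equiv: "edge_equiv Y (word \<alpha>) (word \<alpha>')" "edge_equiv Y (word \<beta>) (word \<beta>')"
      using that by (simp_all add: subdiv_loop_rel_iff)
    have "loop_word Y y0 (word \<alpha> @ word \<beta>)"
      using assms by (simp add: loop_wordD loop_word_append)
    then have "edge_equiv Y (word \<alpha> @ word \<beta>) (word \<alpha>' @ word \<beta>')"
      by (intro edge_equiv_append equiv) (simp add: loop_word_def)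
    then have "loop_class Y y0 (loop_concat \<alpha> \<beta>) = loop_class Y y0 (loop_concat \<alpha>' \<beta>')"
      using loops assms by (simp add: loop_class_eq_iff concat_based_loops word_concat)
    then show ?thesis by simp
  qed
  moreover have "loop_class Y y0 \<alpha> \<noteq> {}" "loop_class Y y0 \<beta> \<noteq> {}"
    using assms[THEN equiv_class_self[OF equiv_subdiv_loop_rel]] by auto
  ultimately have "(\<Union>\<alpha>'\<in>loop_class Y y0 \<alpha>. \<Union>\<beta>'\<in>loop_class Y y0 \<beta>.
      loop_class Y y0 (loop_concat \<alpha>' \<beta>')) = loop_class Y y0 (loop_concat \<alpha> \<beta>)"
    by (intro SUP_eq_const) simp_all
  then show ?thesis by (simp add: fundamental_group_def)
qed

lemma carrier_fundamental_group:
  "carrier (fundamental_group Y y0) = loop_class Y y0 ` based_loops Y y0"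
  by (auto simp: fundamental_group_def quotient_def)

text \<open>
  The isomorphism sends the class of \<open>p \<circ> \<gamma>\<close> to the class of \<open>f \<circ> \<gamma>\<close>.
\<close>

lemma fundamental_group_iso_of_span:
  fixes X :: "'a::tolerance set" and Y :: "'b::tolerance set" and Z :: "'c::tolerance set"
  assumes p: "based_map Z z0 X x0 p" "loop_injective p Z z0 X" "loop_surjective p Z z0 X x0"
    and f: "based_map Z z0 Y y0 f" "loop_injective f Z z0 Y" "loop_surjective f Z z0 Y y0"
  shows "fundamental_group X x0 \<cong> fundamental_group Y y0"
proof -
  \<comment> \<open>\<open>via \<alpha> ps\<close> says that the loop \<open>ps\<close> of \<open>Z\<close> represents the preimage of the class of \<open>\<alpha>\<close> under \<open>p\<close>.\<close>
  define via where "via \<alpha> ps \<longleftrightarrow> loop_word Z z0 ps \<and> edge_equiv X (map p ps) (word \<alpha>)" for \<alpha> ps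
  have ex: "\<exists>\<beta> ps. via \<alpha> ps \<and> \<beta> \<in> based_loops Y y0 \<and> edge_equiv Y (map f ps) (word \<beta>)"
    if \<alpha>: "\<alpha> \<in> based_loops X x0" for \<alpha>
  proof -
    obtain ps where ps: "via \<alpha> ps"
      using p(3) loop_wordD[OF \<alpha>] by (auto simp: via_def loop_surjective_def)
    then have "loop_word Y y0 (map f ps)" using f(1) loop_word_map by (auto simp: via_def)
    then obtain \<beta> where "\<beta> \<in> based_loops Y y0" "edge_equiv Y (word \<beta>) (map f ps)"
      by (rule loop_of_word)
    then show ?thesis using ps edge_equiv.sym by blast
  qed
  \<comment> \<open>The choices of \<open>\<alpha>\<close>, \<open>ps\<close> and \<open>\<beta>\<close> all lead to the same \<open>B\<close> when \<open>A\<close> is a class of loops.\<close>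
  define h where "h A = (SOME B. \<exists>\<alpha>\<in>A. \<exists>\<beta> ps. B = loop_class Y y0 \<beta> \<and> via \<alpha> ps \<and>
      \<beta> \<in> based_loops Y y0 \<and> edge_equiv Y (map f ps) (word \<beta>))" for A
  have h_eq: "h (loop_class X x0 \<alpha>) = loop_class Y y0 \<beta>"
    if "\<alpha> \<in> based_loops X x0" "via \<alpha> ps" "\<beta> \<in> based_loops Y y0" "edge_equiv Y (map f ps) (word \<beta>)"
    for \<alpha> \<beta> ps
    unfolding h_def
  proof (rule some_equality)
    show "\<exists>\<alpha>'\<in>loop_class X x0 \<alpha>. \<exists>\<beta>' ps. loop_class Y y0 \<beta> = loop_class Y y0 \<beta>' \<and> via \<alpha>' ps \<and>
      \<beta>' \<in> based_loops Y y0 \<and> edge_equiv Y (map f ps) (word \<beta>')"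
      using that equiv_class_self[OF equiv_subdiv_loop_rel that(1)] by blast
  next
    fix B assume "\<exists>\<alpha>'\<in>loop_class X x0 \<alpha>. \<exists>\<beta>' ps. B = loop_class Y y0 \<beta>' \<and> via \<alpha>' ps \<and>
      \<beta>' \<in> based_loops Y y0 \<and> edge_equiv Y (map f ps) (word \<beta>')"
    then obtain \<alpha>' \<beta>' qs where *: "edge_equiv X (word \<alpha>) (word \<alpha>')" "B = loop_class Y y0 \<beta>'"
      "via \<alpha>' qs" "\<beta>' \<in> based_loops Y y0" "edge_equiv Y (map f qs) (word \<beta>')"
      by (auto simp: subdiv_loop_rel_iff)
    then have "edge_equiv X (map p ps) (map p qs)"
      using that(2) unfolding via_def by (blast intro: edge_equiv.sym edge_equiv.trans)
    then have "edge_equiv Z ps qs"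
      using p(2) that(2) *(3) by (simp add: via_def loop_injective_def)
    then have "edge_equiv Y (map f ps) (map f qs)"
      by (rule edge_equiv_map) (use f(1) in \<open>simp add: based_map_def\<close>)
    then have "edge_equiv Y (word \<beta>') (word \<beta>)"
      using that(4) *(5) by (blast intro: edge_equiv.sym edge_equiv.trans)
    then show "B = loop_class Y y0 \<beta>" using * that by (simp add: loop_class_eq_iff)
  qed
  have "h \<in> hom (fundamental_group X x0) (fundamental_group Y y0)"
  proof (rule homI)
    fix A assume "A \<in> carrier (fundamental_group X x0)"
    then obtain \<alpha> where "\<alpha> \<in> based_loops X x0" "A = loop_class X x0 \<alpha>"
      by (auto simp: carrier_fundamental_group)
    then show "h A \<in> carrier (fundamental_group Y y0)"
      using ex[of \<alpha>] h_eq unfolding carrier_fundamental_group by blast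
  next
    fix A A' assume "A \<in> carrier (fundamental_group X x0)" "A' \<in> carrier (fundamental_group X x0)"
    then obtain \<alpha> \<alpha>' where \<alpha>: "\<alpha> \<in> based_loops X x0" "A = loop_class X x0 \<alpha>"
      "\<alpha>' \<in> based_loops X x0" "A' = loop_class X x0 \<alpha>'"
      by (auto simp: carrier_fundamental_group)
    obtain \<beta> ps where \<beta>: "via \<alpha> ps" "\<beta> \<in> based_loops Y y0" "edge_equiv Y (map f ps) (word \<beta>)"
      using ex[OF \<alpha>(1)] by blast
    obtain \<beta>' ps' where \<beta>': "via \<alpha>' ps'" "\<beta>' \<in> based_loops Y y0" "edge_equiv Y (map f ps') (word \<beta>')"
      using ex[OF \<alpha>(3)] by blast
    have loop: "loop_word Z z0 (ps @ ps')" using \<beta> \<beta>' by (auto simp: via_def loop_word_append)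
    then have "edge_equiv X (map p ps @ map p ps') (word \<alpha> @ word \<alpha>')"
      using \<beta>(1) \<beta>'(1) loop_word_map[OF loop p(1)]
      by (intro edge_equiv_append) (simp_all add: via_def loop_word_def)
    with loop have "via (loop_concat \<alpha> \<alpha>') (ps @ ps')" by (simp add: via_def word_concat)
    moreover have "edge_equiv Y (map f ps @ map f ps') (word \<beta> @ word \<beta>')"
      using loop_word_map[OF loop f(1)]
      by (intro edge_equiv_append[OF \<beta>(3) \<beta>'(3)]) (simp add: loop_word_def)
    then have "edge_equiv Y (map f (ps @ ps')) (word (loop_concat \<beta> \<beta>'))"
      by (simp add: word_concat)
    ultimately have "h (loop_class X x0 (loop_concat \<alpha> \<alpha>')) = loop_class Y y0 (loop_concat \<beta> \<beta>')"
      by (rule h_eq[OF concat_based_loops[OF \<alpha>(1,3)] _ concat_based_loops[OF \<beta>(2) \<beta>'(2)]])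
    then show "h (A \<otimes>\<^bsub>fundamental_group X x0\<^esub> A') = h A \<otimes>\<^bsub>fundamental_group Y y0\<^esub> h A'"
      using \<alpha> \<beta> \<beta>' h_eq[OF \<alpha>(1) \<beta>] h_eq[OF \<alpha>(3) \<beta>'] by (simp add: mult_loop_class)
  qed
  moreover have "inj_on h (carrier (fundamental_group X x0))"
  proof (rule inj_onI)
    fix A A' assume "A \<in> carrier (fundamental_group X x0)" "A' \<in> carrier (fundamental_group X x0)"
      and eq: "h A = h A'"
    then obtain \<alpha> \<alpha>' where \<alpha>: "\<alpha> \<in> based_loops X x0" "A = loop_class X x0 \<alpha>"
      "\<alpha>' \<in> based_loops X x0" "A' = loop_class X x0 \<alpha>'"
      by (auto simp: carrier_fundamental_group)
    obtain \<beta> ps where \<beta>: "via \<alpha> ps" "\<beta> \<in> based_loops Y y0" "edge_equiv Y (map f ps) (word \<beta>)"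
      using ex[OF \<alpha>(1)] by blast
    obtain \<beta>' ps' where \<beta>': "via \<alpha>' ps'" "\<beta>' \<in> based_loops Y y0" "edge_equiv Y (map f ps') (word \<beta>')"
      using ex[OF \<alpha>(3)] by blast
    have "edge_equiv Y (word \<beta>) (word \<beta>')"
      using eq h_eq[OF \<alpha>(1) \<beta>] h_eq[OF \<alpha>(3) \<beta>'] \<alpha> \<beta> \<beta>' by (simp add: loop_class_eq_iff)
    then have "edge_equiv Y (map f ps) (map f ps')"
      using \<beta>(3) \<beta>'(3) by (blast intro: edge_equiv.sym edge_equiv.trans)
    then have "edge_equiv Z ps ps'"
      using f(2) \<beta>(1) \<beta>'(1) by (simp add: via_def loop_injective_def)
    then have "edge_equiv X (map p ps) (map p ps')"
      by (rule edge_equiv_map) (use p(1) in \<open>simp add: based_map_def\<close>)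
    then have "edge_equiv X (word \<alpha>) (word \<alpha>')"
      using \<beta>(1) \<beta>'(1) unfolding via_def by (blast intro: edge_equiv.sym edge_equiv.trans)
    then show "A = A'" using \<alpha> by (simp add: loop_class_eq_iff)
  qed
  moreover have "carrier (fundamental_group Y y0) \<subseteq> h ` carrier (fundamental_group X x0)"
  proof
    fix B assume "B \<in> carrier (fundamental_group Y y0)"
    then obtain \<beta> where \<beta>: "\<beta> \<in> based_loops Y y0" "B = loop_class Y y0 \<beta>"
      by (auto simp: carrier_fundamental_group)
    obtain ps where ps: "loop_word Z z0 ps" "edge_equiv Y (map f ps) (word \<beta>)"
      using f(3) loop_wordD[OF \<beta>(1)] by (auto simp: loop_surjective_def)
    obtain \<alpha> where \<alpha>: "\<alpha> \<in> based_loops X x0" "edge_equiv X (word \<alpha>) (map p ps)"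
      by (rule loop_of_word[OF loop_word_map[OF ps(1) p(1)]])
    then have "via \<alpha> ps" using ps by (auto simp: via_def intro: edge_equiv.sym)
    then have "B = h (loop_class X x0 \<alpha>)" using h_eq[OF \<alpha>(1) _ \<beta>(1) ps(2)] \<beta>(2) by simp
    then show "B \<in> h ` carrier (fundamental_group X x0)"
      using \<alpha> by (auto simp: carrier_fundamental_group)
  qed
  ultimately have "h \<in> iso (fundamental_group X x0) (fundamental_group Y y0)"
    unfolding iso_iff by (auto dest: hom_carrier)
  then show ?thesis by (rule is_isoI)
qed

text \<open>
  After composition with \<open>\<rho> : S(X, m m') \<rightarrow> S(X, m)\<close>, which is bijective on classes, the map \<open>h\<close> is
  homotopic to the projection \<open>S(X, m m') \<rightarrow> X\<close>, which is bijective on classes as well.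
\<close>

lemma loop_bijective_of_homotopic:
  fixes X :: "(int ^ 'n) set" and h :: "int ^ 'n \<Rightarrow> int ^ 'n"
  assumes "x0 \<in> X" "1 \<le> m"
    and "subdiv_based_homotopic X x0 X x0 m h 1 id"
    and h: "based_map (subdivision X m) (subdiv_base m x0) X x0 h"
  shows "loop_injective h (subdivision X m) (subdiv_base m x0) X"
    and "loop_surjective h (subdivision X m) (subdiv_base m x0) X x0"
proof -
  obtain m' where m': "1 \<le> m'" and hom: "based_homotopic (subdivision X (m * m'))
      (subdiv_base (m * m') x0) X x0 (h \<circ> std_proj m') (std_proj (m * m'))"
    using assms(3) by (auto simp: subdiv_based_homotopic_def)
  let ?S = "subdivision X m" and ?s = "subdiv_base m x0"
    and ?T = "subdivision X (m * m')" and ?t = "subdiv_base (m * m') x0"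
  have mm': "1 \<le> m * m'" using assms m' by simp
  note top_inj = loop_bijective_std_proj(1)[OF assms(2) m' assms(1)]
  note top_surj = loop_bijective_std_proj(2)[OF assms(2) m' assms(1)]
  interpret simply_connected_fibres ?T X "std_proj (m * m')" "subdiv_base (m * m')"
    by (rule std_proj_simply_connected_fibres[OF mm'])
  have proj: "based_map ?T ?t ?S ?s (std_proj m')"
    using std_proj_continuous[OF m', of X m] std_proj_subdiv_base[OF m' assms(2), of x0]
    by (simp add: based_map_def)
  have hom_word: "edge_equiv X (map h (map (std_proj m') ps)) (map (std_proj (m * m')) ps)"
    if "loop_word ?T ?t ps" for ps
    using edge_equiv_based_homotopic[OF hom that] by simp
  show "loop_injective h ?S ?s X"
    unfolding loop_injective_def
  proof (intro allI impI)
    fix ps qs assume loops: "loop_word ?S ?s ps" "loop_word ?S ?s qs"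
      and equiv: "edge_equiv X (map h ps) (map h qs)"
    obtain ps' qs' where *: "loop_word ?T ?t ps'" "edge_equiv ?S (map (std_proj m') ps') ps"
      "loop_word ?T ?t qs'" "edge_equiv ?S (map (std_proj m') qs') qs"
      using top_surj loops unfolding loop_surjective_def by metis
    have "digital_continuous ?S X h" using h by (simp add: based_map_def)
    then have "edge_equiv X (map h (map (std_proj m') ps')) (map h ps)"
      "edge_equiv X (map h (map (std_proj m') qs')) (map h qs)"
      using edge_equiv_map[OF *(2)] edge_equiv_map[OF *(4)] by blast+
    then have "edge_equiv X (map (std_proj (m * m')) ps') (map (std_proj (m * m')) qs')"
      using equiv hom_word[OF *(1)] hom_word[OF *(3)] by (blast intro: edge_equiv.sym edge_equiv.trans)
    then have "edge_equiv ?T ps' qs'"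
      using loop_injective_projection[OF assms(1)] * by (simp add: loop_injective_def)
    then have "edge_equiv ?S (map (std_proj m') ps') (map (std_proj m') qs')"
      by (rule edge_equiv_map) (use proj in \<open>simp add: based_map_def\<close>)
    then show "edge_equiv ?S ps qs" using * by (blast intro: edge_equiv.sym edge_equiv.trans)
  qed
  show "loop_surjective h ?S ?s X x0"
    unfolding loop_surjective_def
  proof (intro allI impI)
    fix xs assume "loop_word X x0 xs"
    then obtain ps where ps: "loop_word ?T ?t ps" "edge_equiv X (map (std_proj (m * m')) ps) xs"
      using loop_surjective_projection[of x0] by (auto simp: loop_surjective_def)
    then have "edge_equiv X (map h (map (std_proj m') ps)) xs"
      using hom_word edge_equiv.trans by blast
    then show "\<exists>ps. loop_word ?S ?s ps \<and> edge_equiv X (map h ps) xs"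
      using loop_word_map[OF ps(1) proj] by blast
  qed
qed

theorem theorem3p19:
  fixes X :: "(int ^ 'm) set" and x0 :: "int ^ 'm"
    and Y :: "(int ^ 'n) set" and y0 :: "int ^ 'n"
  assumes "based_digital_image X x0"
    and "based_digital_image Y y0"
    and "subdiv_based_homotopy_equivalent X x0 Y y0"
  shows "fundamental_group X x0 \<cong> fundamental_group Y y0"
proof -
  obtain k l f g F G where k: "1 \<le> k" and l: "1 \<le> l"
    and f: "based_map (subdivision X k) (subdiv_base k x0) Y y0 f"
    and g: "based_map (subdivision Y l) (subdiv_base l y0) X x0 g"
    and F: "based_map (subdivision X (k * l)) (subdiv_base (k * l) x0)
                  (subdivision Y l) (subdiv_base l y0) F"
    and G: "based_map (subdivision Y (k * l)) (subdiv_base (k * l) y0)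
                  (subdivision X k) (subdiv_base k x0) G"
    and F_lifts: "\<forall>x\<in>subdivision X (k * l). std_proj l (F x) = f (std_proj l x)"
    and fG: "subdiv_based_homotopic Y y0 Y y0 (k * l) (f \<circ> G) 1 id"
    and gF: "subdiv_based_homotopic X x0 X x0 (k * l) (g \<circ> F) 1 id"
    using assms(3) unfolding subdiv_based_homotopy_equivalent_def by blast
  have x0: "x0 \<in> X" and y0: "y0 \<in> Y" using assms by (auto simp: based_digital_image_def)
  have kl: "1 \<le> k * l" using k l by simp
  have comp: "based_map A a C c (v \<circ> u)"
    if "based_map A a B b u" "based_map B b C c v"
    for A :: "'x::tolerance set" and B :: "'y::tolerance set" and C :: "'z::tolerance set" and a b c u v
    using that by (auto simp: based_map_def digital_continuous_def)
  interpret X: simply_connected_fibres "subdivision X k" X "std_proj k" "subdiv_base k"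
    by (rule std_proj_simply_connected_fibres[OF k])
  interpret Y: simply_connected_fibres "subdivision Y l" Y "std_proj l" "subdiv_base l"
    by (rule std_proj_simply_connected_fibres[OF l])
  let ?Xk = "subdivision X k" and ?xk = "subdiv_base k x0"
    and ?Xkl = "subdivision X (k * l)" and ?xkl = "subdiv_base (k * l) x0"
  \<comment> \<open>A pair of loops with equivalent images under \<open>f\<close> is first moved up to \<open>S(X, k l)\<close>, where \<open>F\<close> is
    available, then compared in \<open>X\<close> through \<open>g \<circ> F\<close>.\<close>
  have inj: "loop_injective f ?Xk ?xk Y"
    unfolding loop_injective_def
  proof (intro allI impI)
    fix ps qs assume loops: "loop_word ?Xk ?xk ps" "loop_word ?Xk ?xk qs"
      and equiv: "edge_equiv Y (map f ps) (map f qs)"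
    obtain ps' qs' where *: "loop_word ?Xkl ?xkl ps'" "edge_equiv ?Xk (map (std_proj l) ps') ps"
      "loop_word ?Xkl ?xkl qs'" "edge_equiv ?Xk (map (std_proj l) qs') qs"
      using loop_bijective_std_proj(2)[OF k l x0] loops unfolding loop_surjective_def by metis
    have square: "map f (map (std_proj l) rs) = map (std_proj l) (map F rs)"
      if "loop_word ?Xkl ?xkl rs" for rs
      using that F_lifts by (auto simp: loop_word_def edge_path_def)
    have "digital_continuous ?Xk Y f" using f by (simp add: based_map_def)
    note f_equiv = edge_equiv_map[OF _ this]
    have "edge_equiv Y (map f (map (std_proj l) ps')) (map f (map (std_proj l) qs'))"
      by (rule edge_equiv.trans[OF f_equiv[OF *(2)]
            edge_equiv.trans[OF equiv edge_equiv.sym[OF f_equiv[OF *(4)]]]])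
    then have "edge_equiv Y (map (std_proj l) (map F ps')) (map (std_proj l) (map F qs'))"
      by (simp only: square[OF *(1)] square[OF *(3)])
    then have "edge_equiv (subdivision Y l) (map F ps') (map F qs')"
      using Y.loop_injective_projection[OF y0] * loop_word_map[OF _ F]
      unfolding loop_injective_def by blast
    then have "edge_equiv X (map g (map F ps')) (map g (map F qs'))"
      by (rule edge_equiv_map) (use g in \<open>simp add: based_map_def\<close>)
    then have "edge_equiv ?Xkl ps' qs'"
      using loop_bijective_of_homotopic(1)[OF x0 kl gF comp[OF F g]] *
      unfolding loop_injective_def by simp
    then have "edge_equiv ?Xk (map (std_proj l) ps') (map (std_proj l) qs')"
      using std_proj_continuous[OF l] edge_equiv_map by blast
    then show "edge_equiv ?Xk ps qs" using * by (blast intro: edge_equiv.sym edge_equiv.trans)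
  qed
  have surj: "loop_surjective f ?Xk ?xk Y y0"
    unfolding loop_surjective_def
  proof (intro allI impI)
    fix ys assume "loop_word Y y0 ys"
    then obtain qs where qs: "loop_word (subdivision Y (k * l)) (subdiv_base (k * l) y0) qs"
      "edge_equiv Y (map (f \<circ> G) qs) ys"
      using loop_bijective_of_homotopic(2)[OF y0 kl fG comp[OF G f]]
      by (auto simp: loop_surjective_def)
    then show "\<exists>ps. loop_word ?Xk ?xk ps \<and> edge_equiv Y (map f ps) ys"
      using loop_word_map[OF qs(1) G] by (metis map_map)
  qed
  have "based_map ?Xk ?xk X x0 (std_proj k)"
    using X.cont X.section_eq[OF x0] by (simp add: based_map_def)
  then show ?thesis
    using fundamental_group_iso_of_span[OF _ X.loop_injective_projection[OF x0]
        X.loop_surjective_projection f inj surj] by blast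
qed

end
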